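(* Let $X$ be an absolute Borel space. Then $X$ is $2^\omega$-partitionable if and only if $X$ is $2^\omega$-coverable.
   Context: A space is called an absolute Borel space if it is homeomorphic to a Borel subspace of a completely metrizable space (no separability or cardinality restriction is assumed). $2^\omega$ denotes the Cantor space. A space $X$ is $2^\omega$-partitionable if there is a partition of $X$ (a family of pairwise disjoint subsets with union $X$) each member of which, with the subspace topology, is homeomorphic to $2^\omega$. A space $X$ is $2^\omega$-coverable if there is a family of subsets of $X$ with union $X$, each member of which, with the subspace topology, is homeomorphic to $2^\omega$. *)

theory Defs
  imports "HOL-Analysis.Analysis"
begin

definition cantor_topology :: "(nat \<Rightarrow> bool) topology" where
  "cantor_topology = product_topology (\<lambda>_. discrete_topology UNIV) UNIV"

definition borel_sets_in :: "'a topology \<Rightarrow> 'a set set" where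
  "borel_sets_in X = sigma_sets (topspace X) {U. openin X U}"

(* HOL cannot quantify over types inside a definition, so the type 'b of the points of the
   ambient completely metrizable space Y is an explicit parameter.  A theorem assuming
   absolute_Borel_space TYPE('b) X with 'b a type variable covers every choice of Y. *)
definition absolute_Borel_space :: "'b itself \<Rightarrow> 'a topology \<Rightarrow> bool" where
  "absolute_Borel_space (_ :: 'b itself) X \<longleftrightarrow>
     (\<exists>(Y :: 'b topology) B. completely_metrizable_space Y \<and> B \<in> borel_sets_in Y \<and>
        X homeomorphic_space (subtopology Y B))"

(* partition_on additionally demands nonempty members; here this is automatic, since the
   members are homeomorphic to the nonempty Cantor space. *)
definition cantor_partitionable :: "'a topology \<Rightarrow> bool" where
  "cantor_partitionable X \<longleftrightarrow>
     (\<exists>P. partition_on (topspace X) P \<and>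
        (\<forall>K\<in>P. subtopology X K homeomorphic_space cantor_topology))"

definition cantor_coverable :: "'a topology \<Rightarrow> bool" where
  "cantor_coverable X \<longleftrightarrow>
     (\<exists>C. \<Union>C = topspace X \<and>
        (\<forall>K\<in>C. subtopology X K homeomorphic_space cantor_topology))"

end

theory Submission
  imports Defs
begin

text \<open>Let \<open>X\<close> be a Borel subset of a complete metric space. There is a finer, completely ultrametrizable
  topology on \<open>X\<close>, here given by a decreasing sequence of equivalence relations, for which discrete sets remain
  \<open>\<sigma>\<close>-discrete in the metric; this replaces the Lusin--Souslin theorem when \<open>X\<close> is not separable. A ball of that
  topology with the least number of subballs splits, after removal of one point, into equally many subballs,
  as does each of them in turn. Pairing the subballs up, the tree of these splittings exhibits the ball, minus a
  \<open>\<sigma>\<close>-discrete set, as a product with \<open>2\<^sup>\<omega>\<close>, hence as a disjoint union of Cantor sets. By transfinite exhaustion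
  \<open>X\<close> is a disjoint union of Cantor sets up to a \<open>\<sigma>\<close>-discrete set \<open>E\<close>. If \<open>X\<close> is coverable, then infinitely many
  of these Cantor sets come close to each \<open>x \<in> E\<close>, and \<open>x\<close> is added as the limit of a sequence of small pieces of them.\<close>

section \<open>Copies of the Cantor space\<close>

text \<open>Countable exceptional sets would not do: a tree may lose a point at each of uncountably
  many nodes, and the exhaustion may have uncountably many stages. Being
  \<open>\<sigma>\<close>-discrete survives such unions, provided that the pieces are themselves
  separated by countably many colours; this is why every construction below carries a proof of
  \<open>sigma_sep\<close>. The notion is still small enough: a \<open>\<sigma>\<close>-discrete set
  meets a Cantor set in countably many points, whereas every nonempty relatively open part of a
  Cantor set is uncountable. Hence no such part of a covering Cantor set hides inside
  \<open>E\<close>, which is the one use of coverability. Minimality of the number of subballs lets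
  one label set \<open>J\<close> serve at every node, and for infinite \<open>J\<close> the equality
  of \<open>J \<times> 2\<close> and \<open>J\<close> in cardinality supplies the binary factor. A
  point is removed because a ball that is compact in the finer topology has only finitely many
  subballs of each level, and a finite set does not absorb a factor 2.\<close>

definition agree :: "nat \<Rightarrow> (nat \<Rightarrow> 'c) \<Rightarrow> (nat \<Rightarrow> 'c) \<Rightarrow> bool" where
  "agree n s t \<longleftrightarrow> (\<forall>i<n. s i = t i)"

definition append_at :: "nat \<Rightarrow> (nat \<Rightarrow> 'c) \<Rightarrow> (nat \<Rightarrow> 'c) \<Rightarrow> nat \<Rightarrow> 'c" where
  "append_at n s t i = (if i < n then s i else t (i - n))"

lemma agree_refl [simp]: "agree n s s"
  by (simp add: agree_def)

lemma agree_append_at [simp]: "agree n s (append_at n s t)"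
  by (simp add: agree_def append_at_def)

lemma inj_append_at: "inj (append_at n s)"
proof (rule injI)
  fix t u assume eq: "append_at n s t = append_at n s u"
  show "t = u"
  proof
    fix i show "t i = u i"
      using fun_cong[OF eq, of "i + n"] by (simp add: append_at_def)
  qed
qed

lemma append_at_onto:
  assumes "agree n s t" shows "append_at n s (\<lambda>i. t (i + n)) = t"
  using assms by (auto simp: append_at_def agree_def fun_eq_iff)

lemma openin_cantor:
  "openin cantor_topology U \<longleftrightarrow> (\<forall>s\<in>U. \<exists>n. \<forall>t. agree n s t \<longrightarrow> t \<in> U)"
proof
  assume U: "openin cantor_topology U"
  show "\<forall>s\<in>U. \<exists>n. \<forall>t. agree n s t \<longrightarrow> t \<in> U"
  proof
    fix s assume "s \<in> U"
    then obtain W where W: "finite {i. W i \<noteq> UNIV}" "s \<in> Pi\<^sub>E UNIV W" "Pi\<^sub>E UNIV W \<subseteq> U"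
      using U by (force simp: cantor_topology_def openin_product_topology_alt)
    then obtain n where n: "\<And>i. W i \<noteq> UNIV \<Longrightarrow> i < n"
      using finite_nat_set_iff_bounded by auto
    have "t \<in> U" if "agree n s t" for t
    proof -
      have "t i \<in> W i" for i
      proof (cases "W i = UNIV")
        case False
        then have "t i = s i" using n[of i] that by (simp add: agree_def)
        then show ?thesis using W(2) by (simp add: PiE_iff)
      qed simp
      then show ?thesis using W(3) by auto
    qed
    then show "\<exists>n. \<forall>t. agree n s t \<longrightarrow> t \<in> U" by blast
  qed
next
  assume R: "\<forall>s\<in>U. \<exists>n. \<forall>t. agree n s t \<longrightarrow> t \<in> U"
  show "openin cantor_topology U"
    unfolding cantor_topology_def openin_product_topology_alt
  proof
    fix s assume "s \<in> U"
    then obtain n where n: "\<And>t. agree n s t \<Longrightarrow> t \<in> U" using R by blast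
    define W where "W i = (if i < n then {s i} else UNIV)" for i
    have "finite {i. W i \<noteq> UNIV}"
      by (rule finite_subset[of _ "{..<n}"]) (auto simp: W_def)
    moreover have "s \<in> Pi\<^sub>E UNIV W" by (auto simp: W_def)
    moreover have "Pi\<^sub>E UNIV W \<subseteq> U"
    proof
      fix t assume t: "t \<in> Pi\<^sub>E UNIV W"
      have "agree n s t" unfolding agree_def
      proof (intro allI impI)
        fix i assume "i < n" then show "s i = t i" using PiE_mem[OF t, of i] by (simp add: W_def)
      qed
      then show "t \<in> U" by (rule n)
    qed
    ultimately show "\<exists>Ua. finite {i \<in> UNIV. Ua i \<noteq> topspace (discrete_topology UNIV)} \<and>
              (\<forall>i\<in>UNIV. openin (discrete_topology UNIV) (Ua i)) \<and> s \<in> Pi\<^sub>E UNIV Ua \<and> Pi\<^sub>E UNIV Ua \<subseteq> U"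
      by (intro exI[of _ W]) auto
  qed
qed

lemma topspace_cantor [simp]: "topspace cantor_topology = UNIV"
  by (simp add: cantor_topology_def)

lemma compact_space_cantor: "compact_space cantor_topology"
  unfolding cantor_topology_def
  by (subst compact_space_product_topology) (simp add: compact_space_discrete_topology)

lemma uncountable_agree: "\<not> countable {t :: nat \<Rightarrow> bool. agree n s t}"
proof
  assume "countable {t :: nat \<Rightarrow> bool. agree n s t}"
  moreover have "range (append_at n s) \<subseteq> {t. agree n s t}" by auto
  ultimately have "countable (range (append_at n s))" by (rule countable_subset[rotated])
  then have "countable (UNIV :: (nat \<Rightarrow> bool) set)"
    using countable_image_inj_eq inj_append_at by blast
  then obtain g :: "nat \<Rightarrow> nat \<Rightarrow> bool" where "range g = UNIV"
    using range_from_nat_into[of "UNIV :: (nat \<Rightarrow> bool) set"] by blast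
  then have "(\<lambda>n. \<not> g n n) \<in> range g" by simp
  then obtain k where "(\<lambda>n. \<not> g n n) = g k" by (rule rangeE)
  from fun_cong[OF this, of k] show False by simp
qed

section \<open>Partitions of the Cantor space with members in prescribed cylinders\<close>

lemma inj_choice:
  assumes "countable T" and inf: "\<And>t. t \<in> T \<Longrightarrow> infinite (A t)"
  shows "\<exists>f. inj_on f T \<and> (\<forall>t\<in>T. f t \<in> A t)"
proof -
  \<comment> \<open>The value for the \<open>k\<close>-th element avoids the finite set
    \<open>F\<close> of values used before. A number \<open>k\<close> that enumerates no element of
    \<open>T\<close> merely adds a junk value to the avoided set.\<close>
  define step where "step k F = (SOME y. y \<in> A (inv_into T (to_nat_on T) k) - F)" for k :: nat and F
  define G where "G = rec_nat {} (\<lambda>k F. insert (step k F) F)"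
  have G_Suc: "G (Suc k) = insert (step k (G k)) (G k)" and G0: "G 0 = {}" for k
    by (auto simp: G_def)
  have fin: "finite (G k)" for k by (induction k) (auto simp: G0 G_Suc)
  have mono: "G j \<subseteq> G k" if "j \<le> k" for j k
    using that by (induction rule: dec_induct) (auto simp: G_Suc)
  define f where "f t = step (to_nat_on T t) (G (to_nat_on T t))" for t
  have f: "f t \<in> A t - G (to_nat_on T t)" if "t \<in> T" for t
  proof -
    have "inv_into T (to_nat_on T) (to_nat_on T t) = t"
      using that assms(1) by (intro inv_into_f_f inj_on_to_nat_on)
    moreover have "A t - G (to_nat_on T t) \<noteq> {}"
      using inf[OF that] fin by (metis Diff_eq_empty_iff finite_subset)
    ultimately show ?thesis unfolding f_def step_def by (simp add: some_in_eq del: Diff_iff)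
  qed
  have ne: "f t \<noteq> f u" if "t \<in> T" "u \<in> T" "to_nat_on T t < to_nat_on T u" for t u
  proof -
    have "f t \<in> G (Suc (to_nat_on T t))" by (simp add: G_Suc f_def)
    then have "f t \<in> G (to_nat_on T u)" using mono[of "Suc (to_nat_on T t)" "to_nat_on T u"] that by auto
    then show ?thesis using f[OF that(2)] by auto
  qed
  have "inj_on f T"
  proof (rule inj_onI)
    fix t u assume tu: "t \<in> T" "u \<in> T" "f t = f u"
    then have "to_nat_on T t = to_nat_on T u" using ne by (metis linorder_neqE_nat)
    then show "t = u" using tu assms(1) by simp
  qed
  then show ?thesis using f by blast
qed

text \<open>\<open>2\<^sup>\<omega>\<close> is read as \<open>2\<^sup>\<omega> \<times> 2\<^sup>\<omega>\<close> through the even and odd places, and the fibre over \<open>a\<close> is cut into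
  the \<open>2 ^ m a\<close> cylinders of length \<open>m a\<close>; no continuity of \<open>m\<close> is required.\<close>

definition fibre_eq :: "((nat \<Rightarrow> bool) \<Rightarrow> nat) \<Rightarrow> (nat \<Rightarrow> bool) \<Rightarrow> (nat \<Rightarrow> bool) \<Rightarrow> bool" where
  "fibre_eq m s t \<longleftrightarrow> (\<forall>i. s (2 * i) = t (2 * i)) \<and>
     agree (m (\<lambda>i. s (2 * i))) (\<lambda>i. s (2 * i + 1)) (\<lambda>i. t (2 * i + 1))"

lemma equivp_fibre_eq: "equivp (fibre_eq m)"
proof (rule equivpI)
  have iff: "fibre_eq m s t \<longleftrightarrow> (\<lambda>i. s (2 * i)) = (\<lambda>i. t (2 * i)) \<and>
     agree (m (\<lambda>i. s (2 * i))) (\<lambda>i. s (2 * i + 1)) (\<lambda>i. t (2 * i + 1))" for s t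
    unfolding fibre_eq_def by (simp add: fun_eq_iff)
  show "reflp (fibre_eq m)" by (simp add: reflp_def fibre_eq_def)
  show "symp (fibre_eq m)"
    unfolding symp_def iff by (simp add: agree_def)
  show "transp (fibre_eq m)"
    unfolding transp_def iff by (simp add: agree_def)
qed

text \<open>This parametrises the class of \<open>s\<close>. The number \<open>m\<close> is
  evaluated at the even part of \<open>s\<close>, which is frozen along the class, so the dependence
  on \<open>y\<close> is continuous.\<close>

definition fibre_map :: "((nat \<Rightarrow> bool) \<Rightarrow> nat) \<Rightarrow> (nat \<Rightarrow> bool) \<Rightarrow> (nat \<Rightarrow> bool) \<Rightarrow> nat \<Rightarrow> bool" where
  "fibre_map m s y i = (if even i then s i
     else append_at (m (\<lambda>i. s (2 * i))) (\<lambda>i. s (2 * i + 1)) y (i div 2))"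

lemma inj_fibre_map: "inj (fibre_map m s)"
proof (rule injI)
  fix y z assume eq: "fibre_map m s y = fibre_map m s z"
  have "append_at (m (\<lambda>i. s (2 * i))) (\<lambda>i. s (2 * i + 1)) y = append_at (m (\<lambda>i. s (2 * i))) (\<lambda>i. s (2 * i + 1)) z"
  proof
    fix i show "append_at (m (\<lambda>i. s (2 * i))) (\<lambda>i. s (2 * i + 1)) y i = append_at (m (\<lambda>i. s (2 * i))) (\<lambda>i. s (2 * i + 1)) z i"
      using fun_cong[OF eq, of "2 * i + 1"] by (simp add: fibre_map_def)
  qed
  then show "y = z" by (rule injD[OF inj_append_at])
qed

lemma range_fibre_map: "range (fibre_map m s) = {t. fibre_eq m s t}"
proof (intro equalityI subsetI)
  fix t assume "t \<in> range (fibre_map m s)"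
  then show "t \<in> {t. fibre_eq m s t}"
    by (auto simp: fibre_map_def fibre_eq_def agree_def append_at_def)
next
  fix t assume t: "t \<in> {t. fibre_eq m s t}"
  let ?n = "m (\<lambda>i. s (2 * i))"
  have "fibre_map m s (\<lambda>i. t (2 * (i + ?n) + 1)) i = t i" for i
  proof (cases "even i")
    case True then show ?thesis using t by (auto simp: fibre_map_def fibre_eq_def elim: evenE)
  next
    case False
    then have "i = 2 * (i div 2) + 1" by presburger
    have "append_at ?n (\<lambda>i. s (2 * i + 1)) (\<lambda>i. t (2 * (i + ?n) + 1)) = (\<lambda>i. t (2 * i + 1))"
      by (rule append_at_onto[where t = "\<lambda>i. t (2 * i + 1)"]) (use t in \<open>auto simp: fibre_eq_def\<close>)
    with False \<open>i = _\<close> show ?thesis by (metis fibre_map_def)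
  qed
  then have "t = fibre_map m s (\<lambda>i. t (2 * (i + ?n) + 1))" by (simp add: fun_eq_iff)
  then show "t \<in> range (fibre_map m s)" by blast
qed

lemma agree_fibre_map:
  assumes "agree n y z" shows "agree n (fibre_map m s y) (fibre_map m s z)"
  unfolding agree_def
proof (intro allI impI)
  fix i assume "i < n"
  then have "i div 2 - m (\<lambda>i. s (2 * i)) < n" by linarith
  then show "fibre_map m s y i = fibre_map m s z i"
    using assms by (simp add: fibre_map_def append_at_def agree_def)
qed


text \<open>The cylinders may overlap or coincide. Each admits infinitely many even parts, so the
  countably many \<open>t\<close> can be given distinct even parts \<open>a t\<close>. Then
  \<open>m (a t) = n t\<close> is a consistent demand, and the class with even part
  \<open>a t\<close> whose odd part starts like that of \<open>s t\<close> lies in the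
  cylinder.\<close>

lemma fibres_in_cylinders:
  fixes s :: "'t \<Rightarrow> nat \<Rightarrow> bool" and n :: "'t \<Rightarrow> nat"
  assumes "countable T"
  shows "\<exists>m u. (\<forall>t\<in>T. \<forall>y. fibre_eq m (u t) y \<longrightarrow> agree (n t) (s t) y) \<and>
               (\<forall>t\<in>T. \<forall>t'\<in>T. fibre_eq m (u t) (u t') \<longrightarrow> t = t')"
proof -
  define A where "A t = {a. agree (n t) (\<lambda>i. s t (2 * i)) a}" for t
  have "infinite (A t)" for t
    unfolding A_def using uncountable_agree countable_finite by blast
  then obtain a where a: "inj_on a T" "\<And>t. t \<in> T \<Longrightarrow> a t \<in> A t"
    using inj_choice[OF assms, of A] by blast
  define m where "m b = n (inv_into T a b)" for b
  define u where "u t i = (if even i then a t (i div 2) else s t i)" for t i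
  have m: "m (a t) = n t" if "t \<in> T" for t using a(1) that by (simp add: m_def)
  have ev: "(\<lambda>i. u t (2 * i)) = a t" for t by (simp add: u_def)
  have "agree (n t) (s t) y" if t: "t \<in> T" and y: "fibre_eq m (u t) y" for t y
    unfolding agree_def
  proof (intro allI impI)
    fix i assume i: "i < n t"
    have *: "\<And>i. y (2 * i) = a t i" "agree (n t) (\<lambda>i. s t (2 * i + 1)) (\<lambda>i. y (2 * i + 1))"
      using y ev[of t] m[OF t] unfolding fibre_eq_def by (auto simp: u_def)
    show "s t i = y i"
    proof (cases "even i")
      case True
      then show ?thesis using *(1)[of "i div 2"] a(2)[OF t] i by (auto simp: A_def agree_def)
    next
      case False
      then have "i = 2 * (i div 2) + 1" by presburger
      then show ?thesis using *(2) i unfolding agree_def by (metis div_le_dividend order_le_less_trans)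
    qed
  qed
  moreover have "t = t'" if "t \<in> T" "t' \<in> T" "fibre_eq m (u t) (u t')" for t t'
  proof -
    have "(\<lambda>i. u t (2 * i)) = (\<lambda>i. u t' (2 * i))"
      using that(3) by (simp add: fibre_eq_def)
    then have "a t = a t'" by (simp only: ev)
    then show ?thesis using a(1) that by (auto dest: inj_onD)
  qed
  ultimately show ?thesis by blast
qed

section \<open>Cantor sets in a metric space\<close>

context Metric_space
begin

text \<open>The last clause is continuity, phrased with cylinders. By compactness of the domain such
  an injection is automatically an embedding; see \<open>cantor_set_iff\<close>.\<close>

definition cantor_param :: "((nat \<Rightarrow> bool) \<Rightarrow> 'a) \<Rightarrow> bool" where
  "cantor_param f \<longleftrightarrow> inj f \<and> range f \<subseteq> M \<and>
     (\<forall>s. \<forall>e>0. \<exists>n. \<forall>t. agree n s t \<longrightarrow> d (f s) (f t) < e)"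

definition cantor_set :: "'a set \<Rightarrow> bool" where
  "cantor_set K \<longleftrightarrow> (\<exists>f. cantor_param f \<and> range f = K)"

lemma cantor_set_subset: "cantor_set K \<Longrightarrow> K \<subseteq> M"
  by (auto simp: cantor_set_def cantor_param_def)

lemma cantor_set_nonempty: "cantor_set K \<Longrightarrow> K \<noteq> {}"
  by (auto simp: cantor_set_def)

lemma continuous_map_cantor:
  assumes "range f \<subseteq> M"
  shows "continuous_map cantor_topology mtopology f \<longleftrightarrow>
     (\<forall>s. \<forall>e>0. \<exists>n. \<forall>t. agree n s t \<longrightarrow> d (f s) (f t) < e)"
proof -
  have M: "f s \<in> M" for s using assms by auto
  have "(\<exists>U. openin cantor_topology U \<and> s \<in> U \<and> (\<forall>t\<in>U. f t \<in> mball (f s) e)) \<longleftrightarrow>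
        (\<exists>n. \<forall>t. agree n s t \<longrightarrow> d (f s) (f t) < e)" for s e
  proof
    assume "\<exists>U. openin cantor_topology U \<and> s \<in> U \<and> (\<forall>t\<in>U. f t \<in> mball (f s) e)"
    then obtain U where U: "openin cantor_topology U" "s \<in> U" "\<forall>t\<in>U. f t \<in> mball (f s) e" by blast
    then obtain n where "\<forall>t. agree n s t \<longrightarrow> t \<in> U" unfolding openin_cantor by blast
    then show "\<exists>n. \<forall>t. agree n s t \<longrightarrow> d (f s) (f t) < e" using U(3) by (auto simp: in_mball)
  next
    assume "\<exists>n. \<forall>t. agree n s t \<longrightarrow> d (f s) (f t) < e"
    then obtain n where n: "\<forall>t. agree n s t \<longrightarrow> d (f s) (f t) < e" by blast
    have "openin cantor_topology {t. agree n s t}"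
      unfolding openin_cantor by (auto simp: agree_def intro!: exI[of _ n])
    then show "\<exists>U. openin cantor_topology U \<and> s \<in> U \<and> (\<forall>t\<in>U. f t \<in> mball (f s) e)"
      using n M by (intro exI[of _ "{t. agree n s t}"]) (auto simp: in_mball)
  qed
  then show ?thesis by (simp add: continuous_map_to_metric)
qed

lemma cantor_set_iff:
  assumes "K \<subseteq> M"
  shows "subtopology mtopology K homeomorphic_space cantor_topology \<longleftrightarrow> cantor_set K"
proof
  assume "subtopology mtopology K homeomorphic_space cantor_topology"
  then obtain f where f: "homeomorphic_map cantor_topology (subtopology mtopology K) f"
    using homeomorphic_space homeomorphic_space_sym by blast
  then have r: "range f = K" and inj: "inj f"
    using homeomorphic_imp_surjective_map[OF f] homeomorphic_imp_injective_map[OF f] assms by auto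
  have "continuous_map cantor_topology mtopology f"
    using homeomorphic_imp_continuous_map[OF f] by (simp add: continuous_map_in_subtopology)
  with r inj assms show "cantor_set K"
    using continuous_map_cantor[of f] by (auto simp: cantor_set_def cantor_param_def)
next
  assume "cantor_set K"
  then obtain f where f: "cantor_param f" "range f = K" by (auto simp: cantor_set_def)
  then have "continuous_map cantor_topology (subtopology mtopology K) f"
    using continuous_map_cantor[of f] by (auto simp: continuous_map_in_subtopology cantor_param_def)
  moreover have "Hausdorff_space (subtopology mtopology K)"
    by (simp add: Hausdorff_space_mtopology Hausdorff_space_subtopology)
  ultimately have "homeomorphic_map cantor_topology (subtopology mtopology K) f"
    using f assms by (intro continuous_imp_homeomorphic_map)
      (auto simp: compact_space_cantor cantor_param_def)
  then show "subtopology mtopology K homeomorphic_space cantor_topology"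
    using homeomorphic_space homeomorphic_space_sym by blast
qed

lemma cantor_set_compactin: 
  assumes "cantor_set K" shows "compactin mtopology K"
proof -
  have "compact_space (subtopology mtopology K)"
    using assms cantor_set_iff[OF cantor_set_subset[OF assms]] homeomorphic_compact_space compact_space_cantor by blast
  then show ?thesis
    using cantor_set_subset[OF assms] by (simp add: compactin_subspace)
qed

lemma cantor_set_ball_uncountable:
  assumes "cantor_set K" "x \<in> K" "e > 0"
  shows "\<not> countable (K \<inter> mball x e)"
proof
  assume c: "countable (K \<inter> mball x e)"
  obtain f s where f: "cantor_param f" "range f = K" "x = f s"
    using assms by (auto simp: cantor_set_def)
  then obtain n where n: "\<And>t. agree n s t \<Longrightarrow> d (f s) (f t) < e"
    using assms(3) unfolding cantor_param_def by meson
  have "f ` {t. agree n s t} \<subseteq> K \<inter> mball x e"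
    using f n by (auto simp: in_mball cantor_param_def image_subset_iff)
  then have "countable (f ` {t. agree n s t})" using c countable_subset by blast
  moreover have "inj_on f {t. agree n s t}" using f by (auto simp: cantor_param_def intro: inj_on_subset)
  ultimately show False using uncountable_agree countable_image_inj_eq by blast
qed

definition cantor_partition :: "'a set \<Rightarrow> 'a set set \<Rightarrow> bool" where
  "cantor_partition A P \<longleftrightarrow> \<Union>P = A \<and> disjoint P \<and> (\<forall>K\<in>P. cantor_set K)"

text \<open>Countably many requests for a small piece near \<open>p t\<close> are served by members
  of one and the same partition, different requests by different members even when their points
  \<open>p t\<close> coincide. The partition is that of \<open>fibres_in_cylinders\<close>, carried
  over by \<open>h\<close>. The member \<open>C t\<close> need not contain
  \<open>p t\<close>.\<close>

lemma cantor_partition_subordinate: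
  assumes "cantor_set L" "countable T" "\<And>t. t \<in> T \<Longrightarrow> p t \<in> L" "\<And>t. t \<in> T \<Longrightarrow> 0 < (e t :: real)"
  shows "\<exists>P C. cantor_partition L P \<and> inj_on C T \<and> (\<forall>t\<in>T. C t \<in> P \<and> C t \<subseteq> mball (p t) (e t))"
proof -
  obtain h where h: "cantor_param h" "range h = L" using assms(1) by (auto simp: cantor_set_def)
  then have inj: "inj h" and M: "\<And>s. h s \<in> M" by (auto simp: cantor_param_def)
  have "\<forall>t\<in>T. \<exists>s. h s = p t"
  proof
    fix t assume "t \<in> T"
    then have "p t \<in> range h" using h(2) assms(3) by simp
    then show "\<exists>s. h s = p t" by (metis rangeE)
  qed
  from bchoice[OF this] obtain s where s: "\<forall>t\<in>T. h (s t) = p t" ..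
  have "\<forall>t\<in>T. \<exists>n. \<forall>y. agree n (s t) y \<longrightarrow> d (h (s t)) (h y) < e t"
    using h(1) assms(4) by (simp add: cantor_param_def)
  from bchoice[OF this] obtain n where n: "\<forall>t\<in>T. \<forall>y. agree (n t) (s t) y \<longrightarrow> d (h (s t)) (h y) < e t" ..
  note sn = s[rule_format] n[rule_format]
  from fibres_in_cylinders[OF assms(2), of n s]
  obtain m u where mu': "\<forall>t\<in>T. \<forall>y. fibre_eq m (u t) y \<longrightarrow> agree (n t) (s t) y"
      "\<forall>t\<in>T. \<forall>t'\<in>T. fibre_eq m (u t) (u t') \<longrightarrow> t = t'"
    by (elim exE conjE)
  note mu = mu'[rule_format]
  define F where "F v = h ` {y. fibre_eq m v y}" for v
  have eqv: "fibre_eq m v v" "fibre_eq m v w \<Longrightarrow> fibre_eq m w v"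
       "fibre_eq m v w \<Longrightarrow> fibre_eq m w z \<Longrightarrow> fibre_eq m v z" for v w z
    using equivp_fibre_eq[of m] by (auto dest: equivp_reflp equivp_symp equivp_transp)
  have "cantor_set (F v)" for v
  proof -
    have "\<exists>k. \<forall>t. agree k y t \<longrightarrow> d (h (fibre_map m v y)) (h (fibre_map m v t)) < r" if "r > 0" for y r
      using h(1) that agree_fibre_map unfolding cantor_param_def by meson
    then have "cantor_param (h \<circ> fibre_map m v)"
      using inj M inj_fibre_map[of m v] by (auto simp: cantor_param_def intro: inj_compose)
    moreover have "range (h \<circ> fibre_map m v) = F v"
      unfolding F_def range_fibre_map[symmetric] by (simp add: image_comp)
    ultimately show ?thesis unfolding cantor_set_def by blast
  qed
  moreover have "\<Union>(range F) = L" using h(2) eqv(1) by (auto simp: F_def)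
  moreover have "disjoint (range F)"
  proof (rule disjointI)
    fix A B assume "A \<in> range F" "B \<in> range F" "A \<noteq> B"
    then obtain v w where vw: "A = F v" "B = F w" by auto
    have "A = B" if AB: "A \<inter> B \<noteq> {}"
    proof -
      obtain y where "fibre_eq m v y" "fibre_eq m w y"
        using AB injD[OF inj] unfolding vw F_def by blast
      then have "fibre_eq m v z \<longleftrightarrow> fibre_eq m w z" for z using eqv by meson
      then show ?thesis by (simp add: vw F_def)
    qed
    with \<open>A \<noteq> B\<close> show "A \<inter> B = {}" by blast
  qed
  ultimately have "cantor_partition L (range F)" by (auto simp: cantor_partition_def)
  moreover have "inj_on (F \<circ> u) T"
  proof (rule inj_onI)
    fix t t' assume tt: "t \<in> T" "t' \<in> T" "(F \<circ> u) t = (F \<circ> u) t'"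
    then have "h (u t') \<in> F (u t)" using eqv(1) by (auto simp: F_def)
    then have "fibre_eq m (u t) (u t')" using injD[OF inj] by (auto simp: F_def)
    then show "t = t'" using mu(2) tt by blast
  qed
  moreover have "F (u t) \<subseteq> mball (p t) (e t)" if "t \<in> T" for t
    using mu(1)[OF that] sn(1)[OF that, symmetric] sn(2)[OF that] M by (auto simp: F_def in_mball)
  ultimately show ?thesis by (intro exI[of _ "range F"] exI[of _ "F \<circ> u"]) auto
qed

text \<open>Without the zero sequence, \<open>2\<^sup>\<omega>\<close> is the disjoint union of the
  cylinders of the words \<open>0...01\<close>. The cylinder with \<open>i\<close> zeros is mapped
  onto \<open>C i\<close> and the zero sequence to \<open>x\<close>; the shrinking balls give
  continuity there.\<close>

lemma cantor_set_insert_limit: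
  assumes x: "x \<in> M" and C: "\<And>i::nat. cantor_set (C i)" "\<And>i. x \<notin> C i" "\<And>i. C i \<subseteq> mball x (1 / real (Suc i))"
    and disj: "\<And>i j. i \<noteq> j \<Longrightarrow> C i \<inter> C j = {}"
  shows "cantor_set (insert x (\<Union>i. C i))"
proof -
  have "\<exists>h. cantor_param h \<and> range h = C i" for i using C(1)[of i] by (simp add: cantor_set_def)
  then obtain h where h: "\<And>i. cantor_param (h i)" "\<And>i. range (h i) = C i" by metis
  have hC: "h i y \<in> C i" for i y using h(2) by blast
  have hinj: "h i y = h i z \<Longrightarrow> y = z" for i y z using h(1)[of i] by (auto simp: cantor_param_def dest: injD)
  define f where "f s = (if \<exists>i. s i then (let i = LEAST i. s i in h i (\<lambda>n. s (n + Suc i))) else x)" for s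
  define first where "first s i \<longleftrightarrow> s i \<and> (\<forall>j<i. \<not> s j)" for s and i :: nat
  have first: "f s = h i (\<lambda>n. s (n + Suc i))" if "first s i" for s i
  proof -
    have "(LEAST i. s i) = i" using that by (intro Least_equality) (auto simp: first_def not_less[symmetric])
    then show ?thesis using that by (auto simp: f_def first_def)
  qed
  have none: "f s = x" if "\<forall>i. \<not> s i" for s using that by (simp add: f_def)
  have cases: "(\<forall>i. \<not> s i) \<or> (\<exists>i. first s i)" for s
    unfolding first_def using exists_least_iff[of s] by blast
  have fM: "f s \<in> M" for s
    using cases[of s] none first x hC cantor_set_subset[OF C(1)] by (metis subsetD)
  have "inj f"
  proof (rule injI)
    fix s t assume eq: "f s = f t"
    consider "\<forall>i. \<not> s i" "\<forall>i. \<not> t i" | i where "first s i" "\<forall>i. \<not> t i" | i where "first t i" "\<forall>i. \<not> s i"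
      | i j where "first s i" "first t j" using cases[of s] cases[of t] by blast
    then show "s = t"
    proof cases
      case 1 then show ?thesis by auto
    next
      case 2 then show ?thesis using eq first[OF 2(1)] none[OF 2(2)] hC C(2) by metis
    next
      case 3 then show ?thesis using eq first[OF 3(1)] none[OF 3(2)] hC C(2) by metis
    next
      case 4
      have "i = j" using eq first[OF 4(1)] first[OF 4(2)] hC disj by (metis disjoint_iff)
      then have tl: "(\<lambda>n. s (n + Suc i)) = (\<lambda>n. t (n + Suc i))"
        using eq first[OF 4(1)] first[OF 4(2)] hinj by metis
      show ?thesis
      proof
        fix k
        consider "k < i" | "k = i" | "k > i" by linarith
        then show "s k = t k"
        proof cases
          case 3 then show ?thesis using fun_cong[OF tl, of "k - Suc i"] by simp
        qed (use 4 \<open>i = j\<close> in \<open>auto simp: first_def\<close>)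
      qed
    qed
  qed
  moreover have "\<exists>n. \<forall>t. agree n s t \<longrightarrow> d (f s) (f t) < e" if e: "e > 0" for s e
    using cases[of s]
  proof
    assume s: "\<forall>i. \<not> s i"
    obtain N where N: "1 / real (Suc N) < e" using e nat_approx_posE by blast
    have "d (f s) (f t) < e" if "agree N s t" for t
      using cases[of t]
    proof
      assume "\<forall>i. \<not> t i" then show ?thesis using none s e x by simp
    next
      assume "\<exists>i. first t i"
      then obtain i where i: "first t i" by blast
      then have "N \<le> i" using that s by (auto simp: first_def agree_def not_less[symmetric])
      then have "1 / real (Suc i) \<le> 1 / real (Suc N)" by (simp add: frac_le)
      moreover have "d x (f t) < 1 / real (Suc i)"
      proof -
        have "f t \<in> mball x (1 / real (Suc i))" using C(3)[of i] hC[of i] first[OF i] by (metis subsetD)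
        then show ?thesis by (simp only: in_mball)
      qed
      ultimately show ?thesis using N none[OF s] by simp
    qed
    then show ?thesis by blast
  next
    assume "\<exists>i. first s i"
    then obtain i where i: "first s i" by blast
    obtain n where n: "\<And>y. agree n (\<lambda>n. s (n + Suc i)) y \<Longrightarrow> d (h i (\<lambda>n. s (n + Suc i))) (h i y) < e"
      using h(1)[of i] e unfolding cantor_param_def by meson
    have "d (f s) (f t) < e" if "agree (n + Suc i) s t" for t
    proof -
      have "first t i" using that i by (auto simp: first_def agree_def)
      moreover have "agree n (\<lambda>n. s (n + Suc i)) (\<lambda>n. t (n + Suc i))" using that by (simp add: agree_def)
      ultimately show ?thesis using n first i by simp
    qed
    then show ?thesis by blast
  qed
  moreover have "range f = insert x (\<Union>i. C i)"
  proof (intro equalityI subsetI)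
    fix y assume "y \<in> range f"
    then obtain s where y: "y = f s" by blast
    show "y \<in> insert x (\<Union>i. C i)"
      using cases[of s]
    proof
      assume "\<exists>i. first s i"
      then obtain i where "first s i" ..
      then have "y \<in> C i" using first hC y by simp
      then show ?thesis by blast
    qed (simp add: none y)
  next
    fix y assume "y \<in> insert x (\<Union>i. C i)"
    then consider "y = x" | i z where "y = h i z" using h(2) by blast
    then show "y \<in> range f"
    proof cases
      case 1 then show ?thesis using none[of "\<lambda>_. False"] by (metis rangeI)
    next
      case 2
      define s where "s k = (if k < i then False else if k = i then True else z (k - Suc i))" for k
      have "first s i" by (auto simp: first_def s_def)
      moreover have "(\<lambda>n. s (n + Suc i)) = z" by (auto simp: s_def)
      ultimately have "f s = y" using first 2 by metis
      then show ?thesis by blast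
    qed
  qed
  moreover have "range f \<subseteq> M" using fM by blast
  ultimately show ?thesis unfolding cantor_set_def cantor_param_def by blast
qed

text \<open>The colour doubles as a radius: for an equivalence relation \<open>R\<close>, points of
  colour \<open>n\<close> in different classes are at least \<open>1 / Suc n\<close> apart. With
  equality for \<open>R\<close>, each colour class is uniformly discrete.\<close>

definition sigma_sep :: "'a set \<Rightarrow> ('a \<Rightarrow> 'a \<Rightarrow> bool) \<Rightarrow> bool" where
  "sigma_sep A R \<longleftrightarrow> (\<exists>c::'a \<Rightarrow> nat. \<forall>x\<in>A. \<forall>y\<in>A. c x = c y \<and> d x y < 1 / real (Suc (c x)) \<longrightarrow> R x y)"

abbreviation sigma_discrete :: "'a set \<Rightarrow> bool" where
  "sigma_discrete A \<equiv> sigma_sep A (=)"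

text \<open>Two points of \<open>S\<close> near the same point of a finite \<open>e\<close>-net of
  \<open>L\<close> are each within \<open>2 * e\<close> of it, hence less than \<open>4 * e\<close>
  apart and equal. So \<open>S\<close> injects into the net.\<close>

lemma finite_near_totally_bounded:
  assumes L: "mtotally_bounded L" and "e > 0" and S: "S \<subseteq> M" "\<And>x. x \<in> S \<Longrightarrow> \<exists>z\<in>L. d x z < e"
    and sep: "\<And>x y. x \<in> S \<Longrightarrow> y \<in> S \<Longrightarrow> d x y < 4 * e \<Longrightarrow> x = y"
  shows "finite S"
proof -
  from L[unfolded mtotally_bounded_def, rule_format, OF \<open>e > 0\<close>]
  obtain K where K: "finite K" "K \<subseteq> L" "L \<subseteq> (\<Union>x\<in>K. mball x e)"
    by (elim exE conjE)
  have LM: "L \<subseteq> M" using L by (rule mtotally_bounded_imp_subset)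
  have "\<exists>k\<in>K. d x k < 2 * e" if x: "x \<in> S" for x
  proof -
    obtain z where z: "z \<in> L" "d x z < e" using S(2)[OF x] by blast
    then obtain k where k: "k \<in> K" "d k z < e" using K(3) by (auto simp: in_mball)
    have "d x k \<le> d x z + d z k" using x z k S(1) K(2) LM by (intro triangle) auto
    then show ?thesis using z k commute[of z k] by (intro bexI[of _ k]) auto
  qed
  then obtain k where k: "\<And>x. x \<in> S \<Longrightarrow> k x \<in> K" "\<And>x. x \<in> S \<Longrightarrow> d x (k x) < 2 * e" by metis
  have "inj_on k S"
  proof (rule inj_onI)
    fix x y assume xy: "x \<in> S" "y \<in> S" "k x = k y"
    have "d x y \<le> d x (k x) + d (k x) y" using xy k(1) S(1) K(2) LM by (intro triangle) auto
    moreover have "d (k x) y < 2 * e" using k(2)[OF xy(2)] xy(3) commute[of y "k y"] by simp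
    ultimately have "d x y < 4 * e" using k(2)[OF xy(1)] by linarith
    then show "x = y" using sep xy by blast
  qed
  moreover have "finite (k ` S)" using k(1) K(1) by (meson finite_subset image_subsetI)
  ultimately show ?thesis using finite_imageD by blast
qed

text \<open>Colour by colour, the separation is four times the permitted distance from
  \<open>L\<close>, so every colour contributes finitely many points.\<close>

lemma sigma_discrete_near_cantor_set:
  assumes E: "E \<subseteq> M" and c: "\<And>x y. x \<in> E \<Longrightarrow> y \<in> E \<Longrightarrow> c x = c y \<Longrightarrow> d x y < 1 / real (Suc (c x)) \<Longrightarrow> x = y"
    and L: "cantor_set L"
  shows "countable {x\<in>E. \<exists>z\<in>L. d x z < 1 / (4 * real (Suc (c x)))}"
proof -
  have tb: "mtotally_bounded L" using cantor_set_compactin[OF L] by (rule compactin_imp_mtotally_bounded)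
  have "finite {x\<in>E. c x = n \<and> (\<exists>z\<in>L. d x z < 1 / (4 * real (Suc n)))}" for n
  proof (rule finite_near_totally_bounded[OF tb, of "1 / (4 * real (Suc n))"])
    fix x y assume "x \<in> {x \<in> E. c x = n \<and> (\<exists>z\<in>L. d x z < 1 / (4 * real (Suc n)))}"
      "y \<in> {x \<in> E. c x = n \<and> (\<exists>z\<in>L. d x z < 1 / (4 * real (Suc n)))}"
      "d x y < 4 * (1 / (4 * real (Suc n)))"
    moreover have "4 * (1 / (4 * real (Suc n))) = 1 / real (Suc n)"
      by (simp add: field_simps del: of_nat_Suc)
    ultimately show "x = y" using c[of x y] by simp
  qed (use E in auto)
  then have "countable (\<Union>n. {x\<in>E. c x = n \<and> (\<exists>z\<in>L. d x z < 1 / (4 * real (Suc n)))})"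
    by (intro countable_UN) (auto intro: countable_finite)
  then show ?thesis by (rule countable_subset[rotated]) auto
qed

text \<open>Each point \<open>x\<close> of \<open>E\<close> becomes the limit of Cantor pieces cut out of distinct members of the given partition.
  The radii are small enough that only countably many points draw on the same member, so that the pieces can be
  taken as members of one partition of it.\<close>

lemma cantor_partition_absorb:
  assumes X: "X \<subseteq> M" "E \<subseteq> X" and E: "sigma_discrete E" and Q: "cantor_partition (X - E) Q"
    and cover: "\<And>x. x \<in> E \<Longrightarrow> \<exists>K. x \<in> K \<and> K \<subseteq> X \<and> cantor_set K"
  shows "\<exists>P. cantor_partition X P"
proof -
  obtain c where c: "\<And>x y. x \<in> E \<Longrightarrow> y \<in> E \<Longrightarrow> c x = c y \<Longrightarrow> d x y < 1 / real (Suc (c x)) \<Longrightarrow> x = y"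
    using E unfolding sigma_sep_def by blast
  have EM: "E \<subseteq> M" using X by blast
  \<comment> \<open>The first factor brings \<open>sigma_discrete_near_cantor_set\<close> into play,
    so that only countably many points of \<open>E\<close> draw on one member of \<open>Q\<close>;
    the second makes the pieces shrink to \<open>x\<close>.\<close>
  define e where "e x k = 1 / (4 * real (Suc (c x))) / real (Suc k)" for x k
  have e0: "e x k > 0" for x k by (simp add: e_def)
  have e1: "e x k \<le> 1 / (4 * real (Suc (c x)))" for x k by (simp add: e_def divide_simps)
  have e2: "e x k \<le> 1 / real (Suc k)" for x k by (simp add: e_def divide_simps)
  have Qc: "L \<in> Q \<Longrightarrow> cantor_set L" for L using Q by (simp add: cantor_partition_def)
  have QX: "\<Union>Q = X - E" using Q by (simp add: cantor_partition_def)
  have Qd: "L = L'" if "L \<in> Q" "L' \<in> Q" "z \<in> L" "z \<in> L'" for L L' z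
    using Q that by (auto simp: cantor_partition_def dest: disjointD)
  \<comment> \<open>Otherwise the finitely many members near \<open>x\<close> form a closed set
    missing \<open>x\<close>, so in a small ball about \<open>x\<close> the covering Cantor set
    \<open>K\<close> stays inside \<open>E\<close>. It would have only countably many points
    there.\<close>
  have inf: "infinite {L \<in> Q. L \<inter> mball x (e x k) \<noteq> {}}" (is "infinite ?A") if x: "x \<in> E" for x k
  proof
    assume fin: "finite ?A"
    obtain K where K: "x \<in> K" "K \<subseteq> X" "cantor_set K" using cover[OF x] by blast
    have xM: "x \<in> M" using x EM by blast
    have "closedin mtopology (\<Union>?A)"
      using fin Qc cantor_set_compactin compactin_imp_closedin[OF Hausdorff_space_mtopology]
      by (intro closedin_Union) auto
    moreover have "x \<notin> \<Union>?A" using QX x by blast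
    ultimately have "\<exists>r>0. disjnt (\<Union>?A) (mball x r)"
      using xM by (simp only: closedin_metric) blast
    then obtain r where r: "r > 0" "\<Union>?A \<inter> mball x r = {}" by (auto simp only: disjnt_def)
    have "K \<inter> mball x (min r (e x k)) \<subseteq> {x\<in>E. \<exists>z\<in>K. d x z < 1 / (4 * real (Suc (c x)))}"
    proof
      fix y assume y: "y \<in> K \<inter> mball x (min r (e x k))"
      have "y \<in> E"
      proof (rule ccontr)
        assume "y \<notin> E"
        then obtain L where "L \<in> Q" "y \<in> L" using QX y K(2) by blast
        moreover have "y \<in> mball x r" "y \<in> mball x (e x k)" using y by (auto simp: in_mball)
        ultimately show False using r(2) by blast
      qed
      moreover have "d y y = 0" using \<open>y \<in> E\<close> EM by auto
      ultimately show "y \<in> {x\<in>E. \<exists>z\<in>K. d x z < 1 / (4 * real (Suc (c x)))}"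
        using y by (auto intro!: bexI[of _ y])
    qed
    then have "countable (K \<inter> mball x (min r (e x k)))"
      using sigma_discrete_near_cantor_set[OF EM c K(3)] countable_subset by blast
    then show False using cantor_set_ball_uncountable[OF K(3,1)] r(1) e0 by simp
  qed
  have "\<forall>x\<in>E. \<exists>l. inj l \<and> (\<forall>k. l k \<in> {L \<in> Q. L \<inter> mball x (e x k) \<noteq> {}})"
  proof
    fix x assume "x \<in> E"
    then show "\<exists>l. inj l \<and> (\<forall>k. l k \<in> {L \<in> Q. L \<inter> mball x (e x k) \<noteq> {}})"
      using inj_choice[of "UNIV :: nat set" "\<lambda>k. {L \<in> Q. L \<inter> mball x (e x k) \<noteq> {}}"] inf by simp
  qed
  from bchoice[OF this] obtain l where
    l': "\<forall>x\<in>E. inj (l x) \<and> (\<forall>k. l x k \<in> {L \<in> Q. L \<inter> mball x (e x k) \<noteq> {}})" ..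
  have l_inj: "inj (l x)" and l: "l x k \<in> Q" and l_meets: "l x k \<inter> mball x (e x k) \<noteq> {}"
    if "x \<in> E" for x k using l' that by auto
  define p where "p t = (SOME z. z \<in> l (fst t) (snd t) \<inter> mball (fst t) (e (fst t) (snd t)))" for t
  have p: "p (x, k) \<in> l x k \<inter> mball x (e x k)" if "x \<in> E" for x k
    unfolding p_def fst_conv snd_conv using l_meets[OF that] by (meson ex_in_conv someI_ex)
  define T where "T L = {(x, k). x \<in> E \<and> l x k = L}" for L
  \<comment> \<open>Since \<open>l x\<close> is injective, each \<open>x\<close> addresses
    \<open>L\<close> at most once; counting requests thus amounts to counting the points of
    \<open>E\<close> near \<open>L\<close>.\<close>
  have cT: "countable (T L)" if L: "L \<in> Q" for L
  proof -
    have "inj_on fst (T L)" using l_inj by (auto simp: T_def inj_on_def dest: injD)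
    moreover have "fst ` T L \<subseteq> {x\<in>E. \<exists>z\<in>L. d x z < 1 / (4 * real (Suc (c x)))}"
    proof
      fix x assume "x \<in> fst ` T L"
      then obtain k where "x \<in> E" "l x k = L" by (auto simp: T_def)
      then show "x \<in> {x\<in>E. \<exists>z\<in>L. d x z < 1 / (4 * real (Suc (c x)))}"
        using p[of x k] e1[of x k] by (auto simp: in_mball intro!: bexI[of _ "p (x, k)"])
    qed
    moreover have "countable {x\<in>E. \<exists>z\<in>L. d x z < 1 / (4 * real (Suc (c x)))}"
      by (rule sigma_discrete_near_cantor_set[OF EM c Qc[OF L]])
    ultimately show ?thesis
      using countable_subset countable_image_inj_on by fast
  qed
  \<comment> \<open>Small enough that the ball about \<open>p (x, k)\<close> stays inside the ball
    of radius \<open>e x k\<close> about \<open>x\<close>.\<close>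
  define rad where "rad t = (case t of (x, k) \<Rightarrow> min (e x k) (e x k - d x (p (x, k))))" for t
  have "\<forall>L\<in>Q. \<exists>P C. cantor_partition L P \<and> inj_on C (T L) \<and> (\<forall>t\<in>T L. C t \<in> P \<and> C t \<subseteq> mball (p t) (rad t))"
  proof
    fix L assume L: "L \<in> Q"
    show "\<exists>P C. cantor_partition L P \<and> inj_on C (T L) \<and> (\<forall>t\<in>T L. C t \<in> P \<and> C t \<subseteq> mball (p t) (rad t))"
    proof (rule cantor_partition_subordinate[OF Qc[OF L] cT[OF L]])
      fix t assume "t \<in> T L"
      then obtain x k where t: "t = (x, k)" "x \<in> E" "l x k = L" by (auto simp: T_def)
      show "p t \<in> L" "0 < rad t"
        using p[OF t(2), of k] t e0[of x k] by (auto simp: in_mball rad_def)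
    qed
  qed
  from bchoice[OF this] obtain P where "\<forall>L\<in>Q. \<exists>C. cantor_partition L (P L) \<and> inj_on C (T L) \<and>
      (\<forall>t\<in>T L. C t \<in> P L \<and> C t \<subseteq> mball (p t) (rad t))" ..
  from bchoice[OF this] obtain C where PC: "\<forall>L\<in>Q. cantor_partition L (P L) \<and> inj_on (C L) (T L) \<and>
      (\<forall>t\<in>T L. C L t \<in> P L \<and> C L t \<subseteq> mball (p t) (rad t))" ..
  have P: "cantor_partition L (P L)" and C_inj: "inj_on (C L) (T L)"
    and C: "t \<in> T L \<Longrightarrow> C L t \<in> P L" "t \<in> T L \<Longrightarrow> C L t \<subseteq> mball (p t) (rad t)" if "L \<in> Q" for L t
    using PC that by simp_all
  have PU: "K \<subseteq> L" "cantor_set K" if "L \<in> Q" "K \<in> P L" for L K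
    using P[OF that(1)] that(2) by (auto simp: cantor_partition_def)
  define PP where "PP = (\<Union>L\<in>Q. P L)"
  have PPc: "K \<in> PP \<Longrightarrow> cantor_set K" for K using PU by (auto simp: PP_def)
  have PPd: "K = K'" if "K \<in> PP" "K' \<in> PP" "z \<in> K" "z \<in> K'" for K K' z
  proof -
    obtain L L' where L: "L \<in> Q" "K \<in> P L" "L' \<in> Q" "K' \<in> P L'" using \<open>K \<in> PP\<close> \<open>K' \<in> PP\<close> by (auto simp: PP_def)
    then have "L = L'" using PU(1) that(3,4) Qd by (meson subsetD)
    then show ?thesis using P[OF L(1)] L that(3,4) by (auto simp: cantor_partition_def dest: disjointD)
  qed
  have "\<Union>PP = (\<Union>L\<in>Q. \<Union>(P L))" by (auto simp: PP_def)
  also have "\<dots> = \<Union>Q" using P by (simp add: cantor_partition_def)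
  finally have PPU: "\<Union>PP = X - E" using QX by simp
  define D where "D x k = C (l x k) (x, k)" for x k
  have lT: "l x k \<in> Q" "(x, k) \<in> T (l x k)" if "x \<in> E" for x k
    using l[OF that] that by (auto simp: T_def)
  have D: "D x k \<in> PP" "D x k \<subseteq> l x k" if "x \<in> E" for x k
  proof -
    have "D x k \<in> P (l x k)" using C(1)[OF lT[OF that]] by (simp add: D_def)
    then show "D x k \<in> PP" "D x k \<subseteq> l x k"
      using PU(1)[OF lT(1)[OF that]] lT(1)[OF that, of k] unfolding PP_def by blast+
  qed
  have Dball: "D x k \<subseteq> mball x (1 / real (Suc k))" if x: "x \<in> E" for x k
  proof
    fix z assume "z \<in> D x k"
    then have z: "z \<in> mball (p (x, k)) (rad (x, k))" using C(2)[OF lT[OF x]] unfolding D_def by blast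
    then have "d x z \<le> d x (p (x, k)) + d (p (x, k)) z" using x EM by (intro triangle) (auto simp: in_mball)
    also have "\<dots> < e x k" using z by (auto simp: in_mball rad_def)
    also have "\<dots> \<le> 1 / real (Suc k)" by (rule e2)
    finally show "z \<in> mball x (1 / real (Suc k))" using z x EM by (simp add: in_mball subsetD del: of_nat_Suc)
  qed
  have D_inj: "x = y \<and> j = k" if "x \<in> E" "y \<in> E" "z \<in> D x j" "z \<in> D y k" for x y z j k
  proof -
    have "l x j = l y k" using D(2) that Qd lT(1) by (meson subsetD)
    moreover have "D x j = D y k" using PPd D(1) that by blast
    ultimately have "(x, j) = (y, k)"
      using C_inj[OF lT(1)[OF that(1)]] lT(2)[OF that(1)] lT(2)[OF that(2)] unfolding D_def
      by (metis inj_onD)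
    then show ?thesis by simp
  qed
  have DX: "D x k \<subseteq> X - E" if "x \<in> E" for x k using D(1)[OF that] PPU by blast
  define H where "H x = insert x (\<Union>k. D x k)" for x
  \<comment> \<open>The pieces consumed by some \<open>H x\<close>; the other members of
    \<open>PP\<close> are kept as they are.\<close>
  define U where "U = {D x k | x k. x \<in> E}"
  have H: "cantor_set (H x)" if x: "x \<in> E" for x
    unfolding H_def
  proof (rule cantor_set_insert_limit)
    show "x \<in> M" using x EM by blast
    show "D x i \<inter> D x j = {}" if "i \<noteq> j" for i j using that D_inj[OF x x] by blast
  qed (use D(1)[OF x] PPc DX[OF x] x Dball[OF x] in auto)
  have "cantor_partition X (H ` E \<union> (PP - U))"
    unfolding cantor_partition_def
  proof (intro conjI ballI)
    have "\<Union>(H ` E) = E \<union> \<Union>U" by (auto simp: H_def U_def)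
    moreover have "U \<subseteq> PP" using D(1) by (auto simp: U_def)
    ultimately have "\<Union>(H ` E \<union> (PP - U)) = E \<union> \<Union>PP" by (simp only: Union_Un_distrib) blast
    then show "\<Union>(H ` E \<union> (PP - U)) = X" using PPU X(2) by (simp only:) blast
    fix K assume "K \<in> H ` E \<union> (PP - U)"
    then show "cantor_set K" using H PPc by blast
  next
    have HH: "H x \<inter> H y = {}" if "x \<in> E" "y \<in> E" "x \<noteq> y" for x y
    proof (rule ccontr)
      assume "H x \<inter> H y \<noteq> {}"
      then obtain z where z: "z \<in> H x" "z \<in> H y" by blast
      have "z \<noteq> x" using z(2) DX[OF that(2)] that by (auto simp: H_def)
      moreover have "z \<noteq> y" using z(1) DX[OF that(1)] that by (auto simp: H_def)
      ultimately obtain j k where "z \<in> D x j" "z \<in> D y k" using z by (auto simp: H_def)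
      then show False using D_inj that by blast
    qed
    have HP: "H x \<inter> K = {}" if "x \<in> E" "K \<in> PP - U" for x K
    proof -
      have "D x k \<noteq> K" for k using that by (auto simp: U_def)
      then have "D x k \<inter> K = {}" for k
        using PPd[OF D(1)[OF that(1)], of K] that(2) by blast
      moreover have "x \<notin> K" using PPU that by blast
      ultimately show ?thesis by (auto simp: H_def)
    qed
    show "disjoint (H ` E \<union> (PP - U))"
    proof (rule disjointI)
      fix A B assume AB: "A \<in> H ` E \<union> (PP - U)" "B \<in> H ` E \<union> (PP - U)" "A \<noteq> B"
      show "A \<inter> B = {}"
      proof (cases "A \<in> H ` E"; cases "B \<in> H ` E")
        assume "A \<in> H ` E" "B \<in> H ` E"
        then obtain x y where "x \<in> E" "A = H x" "y \<in> E" "B = H y" by (elim imageE) simp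
        then show ?thesis using HH[of x y] AB(3) by (cases "x = y") simp_all
      next
        assume "A \<in> H ` E" "B \<notin> H ` E"
        then show ?thesis using HP AB(2) by (elim imageE) simp
      next
        assume "A \<notin> H ` E" "B \<in> H ` E"
        then show ?thesis using HP AB(1) by (elim imageE) (simp add: Int_commute)
      next
        assume "A \<notin> H ` E" "B \<notin> H ` E"
        then have "A \<in> PP" "B \<in> PP" using AB(1,2) by simp_all
        then show ?thesis using PPd[of A B] AB(3) by blast
      qed
    qed
  qed
  then show ?thesis by blast
qed

end

section \<open>Borel sets as sets of branches\<close>

text \<open>The points \<open>s j\<close> stand for a branch, of which their classes are the nodes.
  For decreasing equivalence relations this is completeness of the ultrametric having the classes as
  balls, stated without mentioning it.\<close>

definition branch_closed :: "'b set \<Rightarrow> (nat \<Rightarrow> 'b \<Rightarrow> 'b \<Rightarrow> bool) \<Rightarrow> bool" where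
  "branch_closed A R \<longleftrightarrow> (\<forall>s. (\<forall>j. s j \<in> A) \<and> (\<forall>j k. j \<le> k \<longrightarrow> R j (s j) (s k)) \<longrightarrow> (\<exists>x\<in>A. \<forall>j. R j (s j) x))"

lemma branch_closedD:
  assumes "branch_closed A R" "\<And>j. s j \<in> A" "\<And>j k. j \<le> k \<Longrightarrow> R j (s j) (s k)"
  obtains x where "x \<in> A" "\<And>j. R j (s j) x"
  using assms unfolding branch_closed_def by blast

section \<open>Calculus of separation by countably many colours\<close>

context Metric_space
begin

lemma sigma_sep_mono:
  assumes "sigma_sep A R" "B \<subseteq> A" "\<And>x y. x \<in> B \<Longrightarrow> y \<in> B \<Longrightarrow> R x y \<Longrightarrow> Q x y"
  shows "sigma_sep B Q"
  using assms unfolding sigma_sep_def by (meson subsetD)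

lemma sigma_sep_nat: "sigma_sep A (\<lambda>x y. (g x :: nat) = g y)"
  unfolding sigma_sep_def by (rule exI[of _ g]) simp

text \<open>The pairing function dominates both arguments, so a paired colour is a radius small
  enough for either component.\<close>

lemma less_inverse_prod_encode:
  assumes "r < 1 / real (Suc (prod_encode (a, b)))"
  shows "r < 1 / real (Suc a)" "r < 1 / real (Suc b)"
proof -
  have "1 / real (Suc (prod_encode (a, b))) \<le> 1 / real (Suc a)"
    by (intro divide_left_mono) (auto simp: le_prod_encode_1)
  moreover have "1 / real (Suc (prod_encode (a, b))) \<le> 1 / real (Suc b)"
    by (intro divide_left_mono) (auto simp: le_prod_encode_2)
  ultimately show "r < 1 / real (Suc a)" "r < 1 / real (Suc b)" using assms by linarith+
qed

text \<open>The colourings of the fibres are chosen independently of each other. This is harmless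
  because the first component of the pair forces close points into one fibre before the second
  components are compared.\<close>

lemma sigma_sep_fibrewise:
  assumes "sigma_sep A (\<lambda>x y. i x = i y)" and fib: "\<And>x. x \<in> A \<Longrightarrow> sigma_sep {y\<in>A. i y = i x} Q"
  shows "sigma_sep A (\<lambda>x y. i x = i y \<and> Q x y)"
proof -
  obtain c where c: "\<And>x y. x \<in> A \<Longrightarrow> y \<in> A \<Longrightarrow> c x = c y \<Longrightarrow> d x y < 1 / real (Suc (c x)) \<Longrightarrow> i x = i y"
    using assms(1) unfolding sigma_sep_def by blast
  have "\<forall>v \<in> i ` A. \<exists>b::'a \<Rightarrow> nat. \<forall>x\<in>{y\<in>A. i y = v}. \<forall>y\<in>{y\<in>A. i y = v}.
      b x = b y \<and> d x y < 1 / real (Suc (b x)) \<longrightarrow> Q x y"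
    using fib unfolding sigma_sep_def by (intro ballI) (elim imageE, simp)
  from bchoice[OF this] obtain b :: "_ \<Rightarrow> 'a \<Rightarrow> nat" where b: "\<forall>v \<in> i ` A. \<forall>x\<in>{y\<in>A. i y = v}. \<forall>y\<in>{y\<in>A. i y = v}.
      b v x = b v y \<and> d x y < 1 / real (Suc (b v x)) \<longrightarrow> Q x y" ..
  define e where "e x = prod_encode (c x, b (i x) x)" for x
  have "i x = i y \<and> Q x y" if xy: "x \<in> A" "y \<in> A" and e: "e x = e y" "d x y < 1 / real (Suc (e x))" for x y
  proof -
    have eq: "c x = c y" "b (i x) x = b (i y) y" using e(1) by (simp_all add: e_def)
    have "i x = i y" using c[OF xy eq(1)] less_inverse_prod_encode(1)[OF e(2)[unfolded e_def]] by blast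
    moreover have "d x y < 1 / real (Suc (b (i x) x))"
      using less_inverse_prod_encode(2)[OF e(2)[unfolded e_def]] .
    ultimately show ?thesis using b[rule_format, of "i x" x y] xy eq(2) by simp
  qed
  then show ?thesis unfolding sigma_sep_def by blast
qed

lemma sigma_sep_conj:
  assumes "sigma_sep A R" "sigma_sep A Q"
  shows "sigma_sep A (\<lambda>x y. R x y \<and> Q x y)"
proof -
  obtain c where c: "\<And>x y. x \<in> A \<Longrightarrow> y \<in> A \<Longrightarrow> c x = c y \<Longrightarrow> d x y < 1 / real (Suc (c x)) \<Longrightarrow> R x y"
    using assms(1) unfolding sigma_sep_def by blast
  obtain b where b: "\<And>x y. x \<in> A \<Longrightarrow> y \<in> A \<Longrightarrow> b x = b y \<Longrightarrow> d x y < 1 / real (Suc (b x)) \<Longrightarrow> Q x y"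
    using assms(2) unfolding sigma_sep_def by blast
  define e where "e x = prod_encode (c x, b x)" for x
  have "R x y \<and> Q x y" if xy: "x \<in> A" "y \<in> A" and e: "e x = e y" "d x y < 1 / real (Suc (e x))" for x y
    using c[OF xy] b[OF xy] e less_inverse_prod_encode[OF e(2)[unfolded e_def]] by (simp add: e_def)
  then show ?thesis unfolding sigma_sep_def by blast
qed

lemma sigma_sep_all_less:
  assumes "\<And>i. i < n \<Longrightarrow> sigma_sep A (R i)"
  shows "sigma_sep A (\<lambda>x y. \<forall>i<n::nat. R i x y)"
  using assms
proof (induction n)
  case 0
  show ?case by (simp add: sigma_sep_def)
next
  case (Suc n)
  have "sigma_sep A (\<lambda>x y. (\<forall>i<n. R i x y) \<and> R n x y)"
    by (rule sigma_sep_conj) (use Suc in auto)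
  then show ?case by (rule sigma_sep_mono) (auto simp: less_Suc_eq)
qed

text \<open>A coding presents \<open>A\<close> as the set of branches of a tree: the nodes of level \<open>n\<close> are the classes of \<open>R n\<close>,
  and the map from branches to points is a continuous bijection. Its inverse need not be continuous;
  separability by countably many colours replaces continuity in the nonseparable setting.\<close>

definition coding :: "'a set \<Rightarrow> (nat \<Rightarrow> 'a \<Rightarrow> 'a \<Rightarrow> bool) \<Rightarrow> bool" where
  "coding A R \<longleftrightarrow> A \<subseteq> M \<and> (\<forall>n. equivp (R n)) \<and> (\<forall>n x y. R (Suc n) x y \<longrightarrow> R n x y) \<and>
     (\<forall>n. sigma_sep A (R n)) \<and> (\<forall>x\<in>A. \<forall>e>0. \<exists>n. \<forall>y\<in>A. R n x y \<longrightarrow> d x y < e) \<and> branch_closed A R"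

lemma codingD:
  assumes "coding A R"
  shows "A \<subseteq> M" "R n x x" "R n x y \<Longrightarrow> R n y x" "R n x y \<Longrightarrow> R n y z \<Longrightarrow> R n x z"
    "sigma_sep A (R n)" "branch_closed A R" "equivp (R n)"
  using assms unfolding coding_def by (auto intro: equivp_reflp equivp_symp equivp_transp)

lemma codingI:
  assumes "A \<subseteq> M" "\<And>n. equivp (R n)" "\<And>n x y. R (Suc n) x y \<longrightarrow> R n x y" "\<And>n. sigma_sep A (R n)"
    and "\<And>x e. x \<in> A \<Longrightarrow> e > 0 \<Longrightarrow> \<exists>n. \<forall>y\<in>A. R n x y \<longrightarrow> d x y < e" "branch_closed A R"
  shows "coding A R"
  using assms unfolding coding_def by simp

section \<open>Closure properties of codings\<close>

lemma coding_mono: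
  assumes "coding A R" "m \<le> n" "R n x y" shows "R m x y"
  using assms(2,3)
proof (induction rule: inc_induct)
  case (step n)
  then show ?case using assms(1) unfolding coding_def by blast
qed

lemma coding_near:
  assumes "coding A R" "x \<in> A" "e > 0"
  obtains n where "\<And>y. y \<in> A \<Longrightarrow> R n x y \<Longrightarrow> d x y < e"
  using assms unfolding coding_def by blast

lemma coding_eqI:
  assumes R: "coding A R" and xy: "x \<in> A" "y \<in> A" "\<And>n. R n x y"
  shows "x = y"
proof (rule ccontr)
  assume "x \<noteq> y"
  have M: "x \<in> M" "y \<in> M" using xy codingD(1)[OF R] by blast+
  with \<open>x \<noteq> y\<close> have "0 < d x y" by simp
  then obtain n where "\<And>z. z \<in> A \<Longrightarrow> R n x z \<Longrightarrow> d x z < d x y"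
    using coding_near[OF R xy(1)] by blast
  then show False using xy by blast
qed

lemma coding_subset:
  assumes R: "coding A R" and B: "B \<subseteq> A" and bc: "branch_closed B R"
  shows "coding B R"
proof (rule codingI)
  show "B \<subseteq> M" using B codingD(1)[OF R] by blast
  show "equivp (R n)" for n using codingD(7)[OF R] .
  show "R (Suc n) x y \<longrightarrow> R n x y" for n x y using coding_mono[OF R, of n "Suc n"] by auto
  show "sigma_sep B (R n)" for n using codingD(5)[OF R] B by (rule sigma_sep_mono)
  show "branch_closed B R" by (rule bc)
  fix x and e :: real assume "x \<in> B" "e > 0"
  then obtain n where "\<And>y. y \<in> A \<Longrightarrow> R n x y \<Longrightarrow> d x y < e"
    using coding_near[OF R, of x e] B by blast
  then show "\<exists>n. \<forall>y\<in>B. R n x y \<longrightarrow> d x y < e" using B by blast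
qed

text \<open>The representatives \<open>s n\<close> converge in the metric to the point of the
  branch, because the classes at that point shrink to it. A closed set keeps this limit.\<close>

lemma coding_Int_closed:
  assumes R: "coding A R" and C: "closedin mtopology C"
  shows "coding (A \<inter> C) R"
proof -
  have "branch_closed (A \<inter> C) R"
    unfolding branch_closed_def
  proof (intro allI impI)
    fix s assume s: "(\<forall>j. s j \<in> A \<inter> C) \<and> (\<forall>j k. j \<le> k \<longrightarrow> R j (s j) (s k))"
    then obtain x where x: "x \<in> A" "\<And>j. R j (s j) x"
      using branch_closedD[OF codingD(6)[OF R], of s] by blast
    have "x \<in> C"
    proof (rule ccontr)
      assume "x \<notin> C"
      moreover have "x \<in> M" using x(1) codingD(1)[OF R] by blast
      ultimately have "\<exists>r>0. disjnt C (mball x r)" using C by (simp add: closedin_metric)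
      then obtain r where r: "r > 0" "disjnt C (mball x r)" by blast
      obtain n where n: "\<And>y. y \<in> A \<Longrightarrow> R n x y \<Longrightarrow> d x y < r" using coding_near[OF R x(1) r(1)] by blast
      have "s n \<in> A" "s n \<in> C" using s by blast+
      then have "d x (s n) < r" using n codingD(3)[OF R x(2)] by blast
      then have "s n \<in> mball x r" using \<open>x \<in> M\<close> \<open>s n \<in> A\<close> codingD(1)[OF R] by (auto simp: in_mball)
      then show False using r(2) \<open>s n \<in> C\<close> by (auto simp: disjnt_iff)
    qed
    then show "\<exists>x\<in>A \<inter> C. \<forall>j. R j (s j) x" using x by blast
  qed
  then show ?thesis by (rule coding_subset[OF R, rotated]) simp
qed

text \<open>A branch inside \<open>U\<close> may lead to a point outside. To prevent this, every
  level also records the least level \<open>l x\<close> at which the class of \<open>x\<close>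
  within \<open>A\<close> lies in \<open>U\<close>. Along a branch this number is constant, and the
  class of that level contains the limit.\<close>

lemma coding_Int_open:
  assumes R: "coding A R" and U: "openin mtopology U"
  shows "\<exists>R'. coding (A \<inter> U) R'"
proof -
  define P where "P x k \<longleftrightarrow> (\<forall>y\<in>A. R k x y \<longrightarrow> y \<in> U)" for x k
  define l where "l x = (LEAST k. P x k)" for x
  define R' where "R' n x y \<longleftrightarrow> l x = l y \<and> R n x y" for n x y
  have AM: "A \<subseteq> M" using codingD(1)[OF R] .
  have P: "P x (l x)" if x: "x \<in> A \<inter> U" for x
  proof -
    obtain r where r: "r > 0" "mball x r \<subseteq> U" using U x by (auto simp: openin_mtopology)
    obtain n where n: "\<And>y. y \<in> A \<Longrightarrow> R n x y \<Longrightarrow> d x y < r"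
      using coding_near[OF R _ r(1)] x by blast
    have "P x n"
      unfolding P_def
    proof (intro ballI impI)
      fix y assume "y \<in> A" "R n x y"
      then have "y \<in> mball x r" using n x AM by (auto simp: in_mball)
      then show "y \<in> U" using r(2) by blast
    qed
    then show ?thesis unfolding l_def by (rule LeastI)
  qed
  have "equivp (R' n)" for n
  proof (intro equivpI reflpI sympI transpI)
    show "R' n x x" for x using codingD(2)[OF R] by (simp add: R'_def)
    show "R' n x y \<Longrightarrow> R' n y x" for x y using codingD(3)[OF R, of n x y] by (simp add: R'_def)
    show "R' n x y \<Longrightarrow> R' n y z \<Longrightarrow> R' n x z" for x y z
      using codingD(4)[OF R, of n x y z] by (simp add: R'_def)
  qed
  have "sigma_sep (A \<inter> U) (R' n)" for n
    unfolding R'_def by (rule sigma_sep_conj[OF sigma_sep_nat])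
      (use codingD(5)[OF R] in \<open>rule sigma_sep_mono, auto\<close>)
  have "\<exists>n. \<forall>y\<in>A \<inter> U. R' n x y \<longrightarrow> d x y < e" if xe: "x \<in> A \<inter> U" "e > 0" for x e
  proof -
    obtain n where "\<And>y. y \<in> A \<Longrightarrow> R n x y \<Longrightarrow> d x y < e"
      using coding_near[OF R, of x e] xe by blast
    then show ?thesis unfolding R'_def by blast
  qed
  have "branch_closed (A \<inter> U) R'"
    unfolding branch_closed_def
  proof (intro allI impI)
    fix s assume s: "(\<forall>j. s j \<in> A \<inter> U) \<and> (\<forall>j k. j \<le> k \<longrightarrow> R' j (s j) (s k))"
    then obtain x where x: "x \<in> A" "\<And>j. R j (s j) x"
      using branch_closedD[OF codingD(6)[OF R], of s] unfolding R'_def by blast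
    have l: "l (s j) = l (s 0)" for j using s unfolding R'_def by (metis le0)
    define k where "k = l (s 0)"
    have Pk: "P (s k) k" using P[of "s k"] s l[of k] by (simp add: k_def)
    \<comment> \<open>Levels up to \<open>k\<close> do not distinguish \<open>x\<close> from
      \<open>s k\<close>, so the least level of \<open>x\<close> is \<open>k\<close> too.\<close>
    have iff: "P (s k) i \<longleftrightarrow> P x i" if "i \<le> k" for i
    proof -
      have "R i (s k) x" using coding_mono[OF R that x(2)] .
      then show ?thesis unfolding P_def using codingD(3,4)[OF R] by metis
    qed
    have "x \<in> U" using Pk x unfolding P_def by blast
    moreover have "l x = k"
      unfolding l_def
    proof (rule Least_equality)
      show "P x k" using Pk iff by blast
      fix i assume "P x i"
      show "k \<le> i"
      proof (rule ccontr)
        assume "\<not> k \<le> i"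
        then have "P (s k) i" using iff \<open>P x i\<close> by simp
        then have "l (s k) \<le> i" unfolding l_def by (rule Least_le)
        then show False using l[of k] \<open>\<not> k \<le> i\<close> by (simp add: k_def)
      qed
    qed
    ultimately show "\<exists>x\<in>A \<inter> U. \<forall>j. R' j (s j) x"
      using x l by (intro bexI[of _ x]) (auto simp: R'_def k_def)
  qed
  have "R' (Suc n) x y \<longrightarrow> R' n x y" for n x y
    unfolding R'_def using coding_mono[OF R, of n "Suc n"] by auto
  have "A \<inter> U \<subseteq> M" using AM by blast
  have "coding (A \<inter> U) R'" by (rule codingI; fact)
  then show ?thesis by blast
qed

text \<open>Each relation produces its own limit \<open>z i\<close>; all of them are metric limits
  of the same representatives, hence equal. The relation \<open>R i\<close> joins only from level
  \<open>Suc i\<close> on, so that each level combines finitely many relations, as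
  \<open>sigma_sep_all_less\<close> requires.\<close>

lemma coding_INT:
  assumes "\<And>i::nat. \<exists>R. coding (A i) R"
  shows "\<exists>R. coding (\<Inter>i. A i) R"
proof -
  from assms have "\<forall>i. \<exists>R. coding (A i) R" by blast
  from choice[OF this] obtain R where "\<forall>i. coding (A i) (R i)" ..
  then have R: "coding (A i) (R i)" for i by blast
  let ?A = "\<Inter>i. A i"
  define R' where "R' n x y \<longleftrightarrow> (\<forall>i<n. R i n x y)" for n :: nat and x y
  have "equivp (R' n)" for n
  proof (intro equivpI reflpI sympI transpI)
    show "R' n x x" for x using codingD(2)[OF R] by (simp add: R'_def)
    show "R' n x y \<Longrightarrow> R' n y x" for x y using codingD(3)[OF R] by (simp add: R'_def)
    show "R' n x y \<Longrightarrow> R' n y z \<Longrightarrow> R' n x z" for x y z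
      unfolding R'_def using codingD(4)[OF R] by blast
  qed
  have "R' (Suc n) x y \<longrightarrow> R' n x y" for n x y
    unfolding R'_def using coding_mono[OF R, of n "Suc n"] by auto
  have "sigma_sep ?A (R' n)" for n
    unfolding R'_def
  proof (rule sigma_sep_all_less)
    fix i show "sigma_sep ?A (R i n)" using codingD(5)[OF R] by (rule sigma_sep_mono) auto
  qed
  have "\<exists>n. \<forall>y\<in>?A. R' n x y \<longrightarrow> d x y < e" if x: "x \<in> ?A" and "e > 0" for x e
  proof -
    have "x \<in> A 0" using x by blast
    then obtain n where n: "\<And>y. y \<in> A 0 \<Longrightarrow> R 0 n x y \<Longrightarrow> d x y < e"
      using coding_near[OF R _ \<open>e > 0\<close>] by blast
    \<comment> \<open>\<open>Suc n\<close> ensures that \<open>R 0\<close> is among the combined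
      relations even if \<open>n\<close> is 0.\<close>
    have "d x y < e" if "y \<in> ?A" "R' (Suc n) x y" for y
    proof -
      have "R 0 (Suc n) x y" using that(2) by (simp add: R'_def)
      then have "R 0 n x y" by (rule coding_mono[OF R, rotated]) simp
      then show ?thesis using n that(1) by blast
    qed
    then show ?thesis by blast
  qed
  have "branch_closed ?A R'"
    unfolding branch_closed_def
  proof (intro allI impI)
    fix s assume s: "(\<forall>j. s j \<in> ?A) \<and> (\<forall>j k. j \<le> k \<longrightarrow> R' j (s j) (s k))"
    have sA: "s j \<in> A i" for i j using s by blast
    have sM: "s j \<in> M" for j using sA[of j 0] codingD(1)[OF R] by blast
    have sR: "R i j (s k) (s l)" if "j \<le> k" "i < k" "k \<le> l" for i j k l
    proof (rule coding_mono[OF R that(1)])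
      show "R i k (s k) (s l)" using s that unfolding R'_def by blast
    qed
    \<comment> \<open>The shift by \<open>Suc i\<close> skips the levels that \<open>R i\<close> has
      not yet joined.\<close>
    have "\<exists>z. z \<in> A i \<and> (\<forall>j. R i j (s (j + Suc i)) z)" for i
    proof -
      obtain z where "z \<in> A i" "\<And>j. R i j (s (j + Suc i)) z"
        by (rule branch_closedD[OF codingD(6)[OF R[of i]], of "\<lambda>j. s (j + Suc i)"]) (use sA sR in auto)
      then show ?thesis by blast
    qed
    then have "\<forall>i. \<exists>z. z \<in> A i \<and> (\<forall>j. R i j (s (j + Suc i)) z)" by blast
    from choice[OF this] obtain z where z': "\<forall>i. z i \<in> A i \<and> (\<forall>j. R i j (s (j + Suc i)) (z i))" ..
    have zM: "z i \<in> M" for i using z' codingD(1)[OF R] by blast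
    have z: "R i j (s k) (z i)" if "j \<le> k" "i < k" for i j k
    proof -
      have "R i j (s k) (s (k + Suc i))" using sR that by simp
      moreover have "R i j (s (k + Suc i)) (z i)"
        by (rule coding_mono[OF R that(1)]) (use z' in blast)
      ultimately show ?thesis by (rule codingD(4)[OF R])
    qed
    have lim: "\<exists>N. \<forall>k\<ge>N. d (z i) (s k) < e" if "e > 0" for i e
    proof -
      obtain n where n: "\<And>y. y \<in> A i \<Longrightarrow> R i n (z i) y \<Longrightarrow> d (z i) y < e"
        using coding_near[OF R _ \<open>e > 0\<close>] z' by blast
      have "d (z i) (s k) < e" if "k \<ge> n + Suc i" for k
        using n[OF sA] codingD(3)[OF R z[of n k i]] that by simp
      then show ?thesis by blast
    qed
    have zz: "z i = z 0" for i
    proof (rule ccontr)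
      assume "z i \<noteq> z 0"
      then have pos: "d (z i) (z 0) / 2 > 0" using zM by simp
      obtain N where N: "\<forall>k\<ge>N. d (z i) (s k) < d (z i) (z 0) / 2" using lim[OF pos] by blast
      obtain N' where N': "\<forall>k\<ge>N'. d (z 0) (s k) < d (z i) (z 0) / 2" using lim[OF pos] by blast
      have "d (z i) (z 0) \<le> d (z i) (s (N + N')) + d (s (N + N')) (z 0)"
        by (intro triangle zM sM)
      moreover have "d (s (N + N')) (z 0) = d (z 0) (s (N + N'))" by (rule commute)
      moreover have "d (z i) (s (N + N')) < d (z i) (z 0) / 2" "d (z 0) (s (N + N')) < d (z i) (z 0) / 2"
        using N N' by simp_all
      ultimately show False by linarith
    qed
    have "z 0 \<in> ?A" using z' zz by (metis INT_I)
    moreover have "R' j (s j) (z 0)" for j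
      unfolding R'_def using z[of j j] zz by (metis order_refl)
    ultimately show "\<exists>x\<in>?A. \<forall>j. R' j (s j) x" by blast
  qed
  have "?A \<subseteq> M" using codingD(1)[OF R[of 0]] by blast
  have "coding ?A R'" by (rule codingI; fact)
  then show ?thesis by blast
qed

text \<open>The index of the part is recorded at every level, so a branch cannot leave its part.
  Disjointness makes the index of the limit unambiguous.\<close>

lemma coding_disjoint_UN:
  assumes "\<And>i::nat. \<exists>R. coding (A i) R" and disj: "\<And>i j. i \<noteq> j \<Longrightarrow> A i \<inter> A j = {}"
  shows "\<exists>R. coding (\<Union>i. A i) R"
proof -
  from assms(1) have "\<forall>i. \<exists>R. coding (A i) R" by blast
  from choice[OF this] obtain R where "\<forall>i. coding (A i) (R i)" ..
  then have R: "coding (A i) (R i)" for i by blast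
  let ?A = "\<Union>i. A i"
  define i where "i x = (LEAST i. x \<in> A i)" for x
  have iA: "x \<in> A (i x)" if "x \<in> ?A" for x using that unfolding i_def by (auto intro: LeastI)
  have iI: "i x = k" if "x \<in> A k" for x k
  proof -
    have "x \<in> A (i x)" using iA that by blast
    then show ?thesis using disj[of "i x" k] that by blast
  qed
  define R' where "R' n x y \<longleftrightarrow> i x = i y \<and> R (i x) n x y" for n x y
  have "equivp (R' n)" for n
  proof (intro equivpI reflpI sympI transpI)
    show "R' n x x" for x using codingD(2)[OF R] by (simp add: R'_def)
    show "R' n x y \<Longrightarrow> R' n y x" for x y using codingD(3)[OF R, of "i x" n x y] by (auto simp: R'_def)
    show "R' n x y \<Longrightarrow> R' n y z \<Longrightarrow> R' n x z" for x y z
      using codingD(4)[OF R, of "i x" n x y z] by (auto simp: R'_def)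
  qed
  have "R' (Suc n) x y \<longrightarrow> R' n x y" for n x y
    unfolding R'_def using coding_mono[OF R, of n "Suc n"] by auto
  have "sigma_sep ?A (R' n)" for n
    unfolding R'_def
  proof (rule sigma_sep_fibrewise[OF sigma_sep_nat])
    fix x assume "x \<in> ?A"
    show "sigma_sep {y \<in> ?A. i y = i x} (\<lambda>x. R (i x) n x)"
    proof (rule sigma_sep_mono[OF codingD(5)[OF R[of "i x"]]])
      show "{y \<in> ?A. i y = i x} \<subseteq> A (i x)"
      proof
        fix y assume "y \<in> {y \<in> ?A. i y = i x}"
        then show "y \<in> A (i x)" using iA[of y] by simp
      qed
    qed simp
  qed
  have "\<exists>n. \<forall>y\<in>?A. R' n x y \<longrightarrow> d x y < e" if x: "x \<in> ?A" and "e > 0" for x e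
  proof -
    obtain n where n: "\<And>y. y \<in> A (i x) \<Longrightarrow> R (i x) n x y \<Longrightarrow> d x y < e"
      using coding_near[OF R iA[OF x] \<open>e > 0\<close>] by blast
    have "d x y < e" if "y \<in> ?A" "R' n x y" for y
      using n[of y] iA[OF that(1)] that(2) by (auto simp: R'_def)
    then show ?thesis by blast
  qed
  have "branch_closed ?A R'"
    unfolding branch_closed_def
  proof (intro allI impI)
    fix s assume s: "(\<forall>j. s j \<in> ?A) \<and> (\<forall>j k. j \<le> k \<longrightarrow> R' j (s j) (s k))"
    then have si: "i (s j) = i (s 0)" for j unfolding R'_def by (metis le0)
    have sA: "s j \<in> A (i (s 0))" for j unfolding si[of j, symmetric] using s by (intro iA) blast
    obtain x where x: "x \<in> A (i (s 0))" "\<And>j. R (i (s 0)) j (s j) x"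
    proof (rule branch_closedD[OF codingD(6)[OF R[of "i (s 0)"]], of s])
      show "s j \<in> A (i (s 0))" for j by (rule sA)
      show "R (i (s 0)) j (s j) (s k)" if "j \<le> k" for j k
        using s that si[of j] unfolding R'_def by metis
    qed blast
    have "i x = i (s j)" for j using iI[OF x(1)] si[of j] by simp
    then have "R' j (s j) x" for j using x(2)[of j] si[of j] unfolding R'_def by metis
    then show "\<exists>x\<in>?A. \<forall>j. R' j (s j) x" using x(1) by blast
  qed
  have "?A \<subseteq> M" using codingD(1)[OF R] by blast
  have "coding ?A R'" by (rule codingI; fact)
  then show ?thesis by blast
qed

section \<open>Codings of complete spaces and of Borel sets\<close>

lemma coding_empty: "coding {} (\<lambda>_. (=))"
  by (simp add: coding_def branch_closed_def sigma_sep_def identity_equivp)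


text \<open>A point is coded by the first centres, in a well-order, of balls of radius
  \<open>(1/2) ^ n\<close> around it. The limit of a branch cannot fall into an earlier ball, since
  balls are open, but it might reach the boundary of the recorded one. Hence \<open>l\<close> is
  recorded as well: the first level at which the ball of twice the radius, about the centre of that
  level, lies within the ball of level \<open>n\<close>.\<close>

lemma coding_complete:
  assumes "mcomplete"
  shows "\<exists>R. coding M R"
proof -
  obtain r :: "'a rel" where r: "well_order_on UNIV r" using well_order_on by blast
  define lt where "lt x y \<longleftrightarrow> (x, y) \<in> r - Id" for x y
  have "{(x, y). lt x y} = r - Id" by (auto simp: lt_def)
  then have wf: "wf {(x, y). lt x y}" using r by (simp add: well_order_on_def)
  have total: "lt x y \<or> lt y x \<or> x = y" for x y
    using r by (auto simp: lt_def well_order_on_def linear_order_on_def total_on_def)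
  define B where "B n x y \<longleftrightarrow> x \<in> M \<and> y \<in> M \<and> d x y < (1/2) ^ n" for n x y
  define \<phi> where "\<phi> n x = (SOME a. B n a x \<and> (\<forall>b. lt b a \<longrightarrow> \<not> B n b x))" for n x
  have \<phi>: "B n (\<phi> n x) x \<and> (\<forall>b. lt b (\<phi> n x) \<longrightarrow> \<not> B n b x)" if x: "x \<in> M" for n x
  proof -
    have "x \<in> {a. B n a x}" using x by (simp add: B_def)
    then obtain a where "a \<in> {a. B n a x}" "\<And>b. (b, a) \<in> {(x, y). lt x y} \<Longrightarrow> b \<notin> {a. B n a x}"
      using wfE_min[OF wf] by metis
    then have "\<exists>a. B n a x \<and> (\<forall>b. lt b a \<longrightarrow> \<not> B n b x)" by blast
    then show ?thesis unfolding \<phi>_def by (rule someI_ex)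
  qed
  have \<phi>M: "\<phi> n x \<in> M" if "x \<in> M" for n x using \<phi>[OF that] by (auto simp: B_def)
  have \<phi>_eqI: "\<phi> n x = a" if x: "x \<in> M" and a: "B n a x" "\<And>b. lt b a \<Longrightarrow> \<not> B n b x" for n x a
    using total[of a "\<phi> n x"] \<phi>[OF x, of n] a by blast
  \<comment> \<open>The limit is known to be no further than \<open>(1/2) ^ k\<close> from the
    centre of level \<open>k\<close>; the factor 2 turns this into a strict inequality.\<close>
  define Q where "Q n k a b \<longleftrightarrow> (\<forall>z\<in>M. d b z < 2 * (1/2) ^ k \<longrightarrow> d a z < (1/2) ^ n)" for n k :: nat and a b
  define l where "l n x = (LEAST k. Q n k (\<phi> n x) (\<phi> k x))" for n x
  have small_power: "\<exists>k. (1/2) ^ k < (e::real)" if "e > 0" for e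
    using real_arch_pow_inv[of e "1/2"] that by simp
  have Q: "Q n (l n x) (\<phi> n x) (\<phi> (l n x) x)" if x: "x \<in> M" for n x
  proof -
    have "d (\<phi> n x) x < (1/2) ^ n" using \<phi>[OF x, of n] by (simp add: B_def)
    \<comment> \<open>The 3 arises because \<open>z\<close> is within \<open>2 * (1/2) ^ k\<close>
      of the centre \<open>\<phi> k x\<close>, and \<open>x\<close> within \<open>(1/2) ^ k\<close>
      of it.\<close>
    then obtain k where k: "(1/2) ^ k < ((1/2) ^ n - d (\<phi> n x) x) / 3"
      using small_power[of "((1/2) ^ n - d (\<phi> n x) x) / 3"] by auto
    have "Q n k (\<phi> n x) (\<phi> k x)"
      unfolding Q_def
    proof (intro ballI impI)
      fix z assume z: "z \<in> M" "d (\<phi> k x) z < 2 * (1/2) ^ k"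
      have "d (\<phi> n x) z \<le> d (\<phi> n x) x + d x z" by (intro triangle \<phi>M x z)
      moreover have "d x z \<le> d x (\<phi> k x) + d (\<phi> k x) z" by (intro triangle \<phi>M x z)
      moreover have "d x (\<phi> k x) < (1/2) ^ k" using \<phi>[OF x, of k] by (simp add: B_def commute)
      ultimately show "d (\<phi> n x) z < (1/2) ^ n" using z(2) k by argo
    qed
    then show ?thesis unfolding l_def by (rule LeastI)
  qed
  define R where "R n x y \<longleftrightarrow> (\<forall>i<n. \<phi> i x = \<phi> i y \<and> l i x = l i y)" for n x y
  have "equivp (R n)" for n
    by (intro equivpI reflpI sympI transpI) (simp_all add: R_def)
  have "R (Suc n) x y \<longrightarrow> R n x y" for n x y by (simp add: R_def)
  have "sigma_sep M (R n)" for n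
    unfolding R_def
  proof (intro sigma_sep_all_less sigma_sep_conj sigma_sep_nat)
    fix i
    \<comment> \<open>\<open>c x\<close> measures how deep \<open>x\<close> lies in its ball. Two
      close points of equal depth lie in each other's balls, so neither centre precedes the
      other.\<close>
    define P where "P x m \<longleftrightarrow> (\<forall>y\<in>M. d x y < 1 / real (Suc m) \<longrightarrow> B i (\<phi> i x) y)" for x m
    define c where "c x = (LEAST m. P x m)" for x
    have P: "P x (c x)" if x: "x \<in> M" for x
    proof -
      have "0 < (1/2) ^ i - d (\<phi> i x) x" using \<phi>[OF x, of i] by (simp add: B_def)
      then obtain m where m: "1 / real (Suc m) < (1/2) ^ i - d (\<phi> i x) x" by (rule nat_approx_posE)
      have "P x m"
        unfolding P_def
      proof (intro ballI impI)
        fix y assume y: "y \<in> M" "d x y < 1 / real (Suc m)"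
        have "d (\<phi> i x) y \<le> d (\<phi> i x) x + d x y" by (intro triangle \<phi>M x y)
        then show "B i (\<phi> i x) y" using y m \<phi>M[OF x] by (simp add: B_def)
      qed
      then show ?thesis unfolding c_def by (rule LeastI)
    qed
    show "sigma_sep M (\<lambda>x y. \<phi> i x = \<phi> i y)"
      unfolding sigma_sep_def
    proof (intro exI[of _ c] ballI impI)
      fix x y assume xy: "x \<in> M" "y \<in> M" "c x = c y \<and> d x y < 1 / real (Suc (c x))"
      have "B i (\<phi> i x) y" using P[OF xy(1)] xy unfolding P_def by blast
      moreover have "B i (\<phi> i y) x" using P[OF xy(2)] xy commute[of x y] unfolding P_def by auto
      ultimately show "\<phi> i x = \<phi> i y"
        using \<phi>[OF xy(1), of i] \<phi>[OF xy(2), of i] total[of "\<phi> i x" "\<phi> i y"] by blast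
    qed
  qed
  have "\<exists>n. \<forall>y\<in>M. R n x y \<longrightarrow> d x y < e" if x: "x \<in> M" and e: "e > 0" for x e
  proof -
    obtain n where n: "(1/2) ^ n < e / 2" using small_power[of "e / 2"] e by auto
    have "d x y < e" if y: "y \<in> M" "R (Suc n) x y" for y
    proof -
      have "\<phi> n y = \<phi> n x" using y(2) by (simp add: R_def)
      then have "d (\<phi> n x) y < (1/2) ^ n" "d (\<phi> n x) x < (1/2) ^ n"
        using \<phi>[OF x, of n] \<phi>[OF y(1), of n] by (simp_all add: B_def)
      moreover have "d x y \<le> d x (\<phi> n x) + d (\<phi> n x) y" by (intro triangle \<phi>M x y)
      ultimately show ?thesis using n commute[of x "\<phi> n x"] by argo
    qed
    then show ?thesis by blast
  qed
  have "branch_closed M R"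
    unfolding branch_closed_def
  proof (intro allI impI)
    fix s assume s: "(\<forall>j. s j \<in> M) \<and> (\<forall>j k. j \<le> k \<longrightarrow> R j (s j) (s k))"
    then have sM: "s j \<in> M" for j by blast
    \<comment> \<open>Index \<open>i\<close> is first seen by \<open>R\<close> at level
      \<open>Suc i\<close>.\<close>
    define a where "a i = \<phi> i (s (Suc i))" for i
    define m where "m i = l i (s (Suc i))" for i
    have stable: "\<phi> i (s k) = a i" "l i (s k) = m i" if "i < k" for i k
    proof -
      have "R (Suc i) (s (Suc i)) (s k)" using s that by simp
      then show "\<phi> i (s k) = a i" "l i (s k) = m i" by (simp_all add: R_def a_def m_def)
    qed
    have aM: "a i \<in> M" for i using \<phi>M sM by (simp add: a_def)
    have as: "d (a i) (s k) < (1/2) ^ i" if "i < k" for i k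
      using \<phi>[OF sM, of i k] stable(1)[OF that] by (simp add: B_def)
    have "MCauchy s"
      unfolding MCauchy_def
    proof (intro conjI allI impI)
      show "range s \<subseteq> M" using sM by blast
      fix e :: real assume "e > 0"
      then obtain n where n: "(1/2) ^ n < e / 2" using small_power[of "e / 2"] by auto
      have "d (s k) (s k') < e" if "Suc n \<le> k" "Suc n \<le> k'" for k k'
      proof -
        have "d (s k) (s k') \<le> d (s k) (a n) + d (a n) (s k')" by (intro triangle sM aM)
        moreover have "d (a n) (s k) < (1/2) ^ n" "d (a n) (s k') < (1/2) ^ n"
          using as that by simp_all
        ultimately show ?thesis using n commute[of "s k" "a n"] by argo
      qed
      then show "\<exists>N. \<forall>n n'. N \<le> n \<longrightarrow> N \<le> n' \<longrightarrow> d (s n) (s n') < e" by blast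
    qed
    then obtain x where lim: "limitin mtopology s x sequentially"
      using assms unfolding mcomplete_def by blast
    have x: "x \<in> M" using limitin_topspace[OF lim] by simp
    have lim': "\<exists>N. \<forall>k\<ge>N. d (s k) x < e" if "e > 0" for e
      using lim that unfolding limit_metric_sequentially by blast
    have ax: "d (a i) x < 2 * (1/2) ^ i" for i
    proof -
      obtain N where N: "\<forall>k\<ge>N. d (s k) x < (1/2) ^ i" using lim'[of "(1/2) ^ i"] by auto
      have "d (a i) x \<le> d (a i) (s (N + Suc i)) + d (s (N + Suc i)) x" by (intro triangle sM aM x)
      moreover have "d (s (N + Suc i)) x < (1/2) ^ i" using N by simp
      moreover have "d (a i) (s (N + Suc i)) < (1/2) ^ i" by (rule as) simp
      ultimately show ?thesis by argo
    qed
    have Qs: "Q i (l i (s k)) (\<phi> i (s k)) (\<phi> (l i (s k)) (s k))" for i k using Q[OF sM] .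
    have Qm: "Q i (m i) (a i) (a (m i))" for i
    proof -
      have "i < Suc (i + m i)" "m i < Suc (i + m i)" by simp_all
      then show ?thesis using Qs[of i "Suc (i + m i)"] stable by simp
    qed
    have \<phi>x: "\<phi> i x = a i" for i
    proof (rule \<phi>_eqI[OF x])
      have "d (a i) x < (1/2) ^ i" using Qm[of i] ax[of "m i"] x unfolding Q_def by blast
      then show "B i (a i) x" using aM x by (simp add: B_def)
      fix b assume b: "lt b (a i)"
      show "\<not> B i b x"
      proof
        assume bx: "B i b x"
        then have "0 < (1/2) ^ i - d b x" by (simp add: B_def)
        then obtain N where N: "\<forall>k\<ge>N. d (s k) x < (1/2) ^ i - d b x" using lim' by blast
        let ?k = "N + Suc i"
        have "b \<in> M" using bx by (simp add: B_def)
        then have "d b (s ?k) \<le> d b x + d x (s ?k)" by (intro triangle sM x)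
        moreover have "d (s ?k) x < (1/2) ^ i - d b x" using N by simp
        ultimately have "B i b (s ?k)" using \<open>b \<in> M\<close> sM commute[of x "s ?k"] by (simp add: B_def)
        moreover have "\<phi> i (s ?k) = a i" by (rule stable) simp
        ultimately show False using \<phi>[OF sM, of i ?k] b by simp
      qed
    qed
    have lx: "l i x = m i" for i
      unfolding l_def
    proof (rule Least_equality)
      show "Q i (m i) (\<phi> i x) (\<phi> (m i) x)" using Qm by (simp add: \<phi>x)
      fix k assume k: "Q i k (\<phi> i x) (\<phi> k x)"
      show "m i \<le> k"
      proof (rule ccontr)
        assume "\<not> m i \<le> k"
        \<comment> \<open>Beyond \<open>i\<close> and \<open>m i\<close>, hence beyond
          \<open>k\<close> as well: all values that are compared have become stable.\<close>
        let ?k = "Suc (i + m i)"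
        have "\<phi> i (s ?k) = a i" "\<phi> k (s ?k) = a k" "l i (s ?k) = m i" using \<open>\<not> m i \<le> k\<close> by (auto intro: stable)
        then have "Q i k (\<phi> i (s ?k)) (\<phi> k (s ?k))" using k by (simp add: \<phi>x)
        then have "l i (s ?k) \<le> k" unfolding l_def by (rule Least_le)
        then show False using \<open>l i (s ?k) = m i\<close> \<open>\<not> m i \<le> k\<close> by simp
      qed
    qed
    have "R j (s j) x" for j unfolding R_def using \<phi>x lx stable by simp
    then show "\<exists>x\<in>M. \<forall>j. R j (s j) x" using x by blast
  qed
  have "M \<subseteq> M" by simp
  have "coding M R" by (rule codingI; fact)
  then show ?thesis by blast
qed

text \<open>Nothing above leads from a coding of a set to one of its complement, so the induction
  treats both together; unions are first made disjoint.\<close>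

lemma coding_borel:
  assumes "mcomplete" "A \<in> borel_sets_in mtopology"
  shows "\<exists>R. coding A R"
proof -
  obtain R0 where R0: "coding M R0" using coding_complete[OF assms(1)] by blast
  have "(\<exists>R. coding A R) \<and> (\<exists>R. coding (M - A) R) \<and> A \<subseteq> M"
    using assms(2) unfolding borel_sets_in_def
  proof (induction rule: sigma_sets.induct)
    case (Basic U)
    then have U: "openin mtopology U" by simp
    then have UM: "U \<subseteq> M" using openin_subset by fastforce
    have "\<exists>R. coding (M \<inter> U) R" by (rule coding_Int_open[OF R0 U])
    moreover have "coding (M \<inter> (M - U)) R0"
      using U UM by (intro coding_Int_closed[OF R0]) (simp add: closedin_def double_diff)
    ultimately show ?case using UM by (auto simp: Int_absorb1 Int_Diff)
  next
    case Empty
    then show ?case using coding_empty R0 by auto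
  next
    case (Compl A)
    then show ?case by (auto simp: double_diff)
  next
    case (Union A)
    \<comment> \<open>Index 0 stands for \<open>A i\<close> and index \<open>Suc k\<close> removes
      \<open>A k\<close>. From index \<open>Suc i\<close> on, copies of \<open>A i\<close> pad the
      family so that \<open>coding_INT\<close> applies.\<close>
    define C where "C i k = (case k of 0 \<Rightarrow> A i | Suc k \<Rightarrow> if k < i then M - A k else A i)" for i k :: nat
    have "\<exists>R. coding (C i k) R" for i k using Union by (cases k) (simp_all add: C_def)
    then have D: "\<exists>R. coding (\<Inter>k. C i k) R" for i by (intro coding_INT)
    have Ceq: "(\<Inter>k. C i k) = A i - (\<Union>j<i. A j)" for i
    proof (intro equalityI subsetI)
      fix x assume x: "x \<in> (\<Inter>k. C i k)"
      have "x \<in> A i" using INT_D[OF x, of 0] by (simp add: C_def)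
      moreover have "x \<notin> A j" if "j < i" for j using INT_D[OF x, of "Suc j"] that by (simp add: C_def)
      ultimately show "x \<in> A i - (\<Union>j<i. A j)" by blast
    next
      fix x assume "x \<in> A i - (\<Union>j<i. A j)"
      then have "x \<in> C i k" for k using Union by (cases k) (auto simp: C_def)
      then show "x \<in> (\<Inter>k. C i k)" by blast
    qed
    have 1: "\<exists>R. coding (\<Union>i. \<Inter>k. C i k) R"
    proof (rule coding_disjoint_UN[OF D])
      fix i j :: nat assume "i \<noteq> j"
      then show "(\<Inter>k. C i k) \<inter> (\<Inter>k. C j k) = {}"
        unfolding Ceq by (cases "i < j") auto
    qed
    have 2: "(\<Union>i. \<Inter>k. C i k) = (\<Union>i. A i)"
    proof (intro equalityI subsetI)
      fix x assume "x \<in> (\<Union>i. A i)"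
      then have ex: "\<exists>i. x \<in> A i" by blast
      have "x \<in> A (LEAST i. x \<in> A i)" using ex by (rule LeastI_ex)
      moreover have "x \<notin> A j" if "j < (LEAST i. x \<in> A i)" for j using not_less_Least[OF that] .
      ultimately show "x \<in> (\<Union>i. \<Inter>k. C i k)" unfolding Ceq by blast
    qed (auto simp: Ceq)
    have 3: "\<exists>R. coding (\<Inter>i. M - A i) R" using Union by (intro coding_INT) blast
    have 4: "M - (\<Union>i. A i) = (\<Inter>i. M - A i)" by auto
    have "(\<Union>i. A i) \<subseteq> M" using Union by blast
    with 1 3 show ?case by (simp only: 2 4 simp_thms)
  qed
  then show ?thesis by blast
qed

end

section \<open>Homogeneous trees\<close>

lemma lepoll_iff_ordLeq: "A \<lesssim> B \<longleftrightarrow> ordLeq3 (card_of A) (card_of B)"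
  unfolding lepoll_def card_of_ordLeq[symmetric] ..

lemma lepoll_linear: "A \<lesssim> B \<or> B \<lesssim> A"
  unfolding lepoll_iff_ordLeq by (rule ordLeq_total) (rule card_of_Well_order)+

lemma UN_nat_lepoll:
  assumes "infinite B" "\<And>n::nat. A n \<lesssim> B"
  shows "(\<Union>n. A n) \<lesssim> B"
  using assms unfolding lepoll_iff_ordLeq
  by (intro card_of_UNION_ordLeq_infinite) (auto simp: infinite_iff_card_of_nat)

lemma times_bool_eqpoll: "infinite A \<Longrightarrow> A \<times> (UNIV :: bool set) \<approx> A"
  unfolding eqpoll_iff_card_of_ordIso
  using card_of_Times_infinite[of A "UNIV :: bool set"] finite_lepoll_infinite[of A "UNIV :: bool set"]
  by (simp add: lepoll_iff_ordLeq)

lemma exists_minimal_lepoll: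
  assumes "S \<noteq> {}" shows "\<exists>A\<in>S. \<forall>B\<in>S. f A \<lesssim> f B"
  using exists_minim_Well_order[of "card_of ` f ` S"] assms
  unfolding lepoll_iff_ordLeq by (simp add: card_of_Well_order)

section \<open>Cells of a coding and how many there are\<close>

definition cell :: "(nat \<Rightarrow> 'b \<Rightarrow> 'b \<Rightarrow> bool) \<Rightarrow> 'b set \<Rightarrow> nat \<Rightarrow> 'b \<Rightarrow> 'b set" where
  "cell R B n x = {y\<in>B. R n x y}"

definition level :: "(nat \<Rightarrow> 'b \<Rightarrow> 'b \<Rightarrow> bool) \<Rightarrow> 'b set \<Rightarrow> nat \<Rightarrow> 'b set set" where
  "level R B n = cell R B n ` B"

text \<open>The cardinality of this set is the size of \<open>B\<close> that gets minimised. A set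
  that is a cell of several levels is counted once.\<close>

definition cells :: "(nat \<Rightarrow> 'b \<Rightarrow> 'b \<Rightarrow> bool) \<Rightarrow> 'b set \<Rightarrow> 'b set set" where
  "cells R B = (\<Union>n. level R B n)"

context Metric_space
begin

context
  fixes Z :: "'a set" and R :: "nat \<Rightarrow> 'a \<Rightarrow> 'a \<Rightarrow> bool"
  assumes R: "coding Z R"
begin

lemma cell_eq: "R n x y \<Longrightarrow> cell R B n x = cell R B n y"
proof -
  assume xy: "R n x y"
  have "R n x z \<longleftrightarrow> R n y z" for z
    using codingD(4)[OF R xy] codingD(4)[OF R codingD(3)[OF R xy]] by blast
  then show ?thesis by (simp add: cell_def)
qed

lemma cell_self: "x \<in> B \<Longrightarrow> x \<in> cell R B n x"
  by (simp add: cell_def codingD(2)[OF R])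

lemma level_eqI: "C \<in> level R B n \<Longrightarrow> x \<in> C \<Longrightarrow> C = cell R B n x"
proof -
  assume C: "C \<in> level R B n" "x \<in> C"
  then obtain a where a: "C = cell R B n a" by (auto simp: level_def)
  then have "R n a x" using C(2) by (simp add: cell_def)
  then show ?thesis unfolding a by (rule cell_eq)
qed

lemma level_cell: "x \<in> B \<Longrightarrow> cell R B n x \<in> level R B n"
  by (simp add: level_def)

lemma level_nonempty: "C \<in> level R B n \<Longrightarrow> C \<noteq> {}"
  using cell_self by (auto simp: level_def)

lemma level_subset: "C \<in> level R B n \<Longrightarrow> C \<subseteq> B"
  by (auto simp: level_def cell_def)

lemma cells_cell: "x \<in> B \<Longrightarrow> cell R B n x \<in> cells R B"
  by (auto simp: cells_def level_def)

lemma cells_subset: "C \<in> cells R B \<Longrightarrow> C \<subseteq> B"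
  using level_subset by (auto simp: cells_def)

lemma cells_nonempty: "C \<in> cells R B \<Longrightarrow> C \<noteq> {}"
  using level_nonempty by (auto simp: cells_def)

lemma cellsE:
  assumes "C \<in> cells R B" obtains n where "\<And>x. x \<in> C \<Longrightarrow> C = cell R B n x"
  using assms level_eqI unfolding cells_def by blast

text \<open>A cell of level \<open>k\<close> does not split at levels up to \<open>k\<close>, hence
  the maximum.\<close>

lemma cell_cell: "x \<in> cell R B k y \<Longrightarrow> cell R (cell R B k y) n x = cell R B (max k n) x"
proof (intro equalityI subsetI)
  fix z assume x: "x \<in> cell R B k y" and "z \<in> cell R (cell R B k y) n x"
  then have z: "z \<in> B" "R k y z" "R n x z" "R k y x" by (auto simp: cell_def)
  then have "R k x z" using codingD(4)[OF R codingD(3)[OF R z(4)] z(2)] by blast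
  then show "z \<in> cell R B (max k n) x" using z by (auto simp: cell_def max_def)
next
  fix z assume x: "x \<in> cell R B k y" and "z \<in> cell R B (max k n) x"
  then have z: "z \<in> B" "R (max k n) x z" "R k y x" by (auto simp: cell_def)
  then have "R k x z" "R n x z"
    using coding_mono[OF R, of k "max k n" x z] coding_mono[OF R, of n "max k n" x z] by simp_all
  then show "z \<in> cell R (cell R B k y) n x"
    using z codingD(4)[OF R, of k y x z] by (simp add: cell_def)
qed

lemma cells_trans:
  assumes B': "B' \<in> cells R B" and C: "C \<in> cells R B'"
  shows "C \<in> cells R B"
proof -
  obtain x n where x: "x \<in> B'" "C = cell R B' n x" using C by (auto simp: cells_def level_def)
  obtain k where k: "\<And>x. x \<in> B' \<Longrightarrow> B' = cell R B k x" using cellsE[OF B'] by blast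
  have "C = cell R B (max k n) x" using x k[OF x(1)] cell_cell[of x B k x n] by simp
  then show ?thesis using cells_cell x(1) cells_subset[OF B'] by blast
qed

lemma level_lepoll_mono:
  assumes "n \<le> m" shows "level R B n \<lesssim> level R B m"
proof (rule subset_image_lepoll)
  show "level R B n \<subseteq> (\<lambda>C. cell R B n (SOME x. x \<in> C)) ` level R B m"
  proof
    fix C assume C: "C \<in> level R B n"
    then obtain x where x: "x \<in> C" "x \<in> B" using level_nonempty[OF C] level_subset[OF C] by blast
    define y where "y = (SOME y. y \<in> cell R B m x)"
    have "y \<in> cell R B m x" unfolding y_def using cell_self[OF x(2)] by (rule someI)
    then have "R n x y" using coding_mono[OF R assms] by (simp add: cell_def)
    then have "cell R B n y = C" using level_eqI[OF C x(1)] cell_eq by simp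
    then show "C \<in> (\<lambda>C. cell R B n (SOME x. x \<in> C)) ` level R B m"
      using level_cell[OF x(2)] unfolding y_def by blast
  qed
qed

text \<open>Removing a point \<open>p\<close> makes even a compact cell split into infinitely many cells, the maximal ones that
  avoid \<open>p\<close>. Cutting these further reaches the cardinality of the set of all cells; when no single level of one
  of them is that large, the levels of one member are matched with suitable levels of the others.\<close>

lemma homogeneous_split:
  assumes noniso: "\<And>x n. x \<in> Z \<Longrightarrow> cell R Z n x \<noteq> {x}"
    and V: "V \<in> cells R Z" and hom: "\<And>C. C \<in> cells R V \<Longrightarrow> cells R C \<approx> J"
    and B: "B \<in> cells R V"
  shows "\<exists>p P. p \<in> B \<and> P \<subseteq> cells R B \<and> disjoint P \<and> \<Union>P = B - {p} \<and>
           (\<forall>C\<in>P. \<forall>x\<in>C. \<forall>y\<in>C. R N x y) \<and> infinite P \<and> P \<approx> J"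
proof -
  have BZ: "B \<in> cells R Z" using cells_trans[OF V B] .
  have BsubZ: "B \<subseteq> Z" using cells_subset[OF BZ] .
  obtain p where p: "p \<in> B" using cells_nonempty[OF B] by blast
  obtain k where k: "\<And>x. x \<in> B \<Longrightarrow> B = cell R Z k x" using cellsE[OF BZ] by blast
  \<comment> \<open>The level at which \<open>y\<close> parts from \<open>p\<close>. It is constant
    on \<open>S y\<close>, which is why two of these cells are equal or disjoint.\<close>
  define n where "n y = (LEAST n. \<not> R n p y)" for y
  define S where "S y = cell R B (n y) y" for y
  have n: "\<not> R (n y) p y" if "y \<in> B - {p}" for y
  proof -
    have "\<exists>n. \<not> R n p y" using coding_eqI[OF R, of p y] that p BsubZ by blast
    then show ?thesis unfolding n_def by (rule LeastI_ex)
  qed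
  have n_less: "R i p y" if "i < n y" for i y using not_less_Least[of i "\<lambda>n. \<not> R n p y"] that by (simp add: n_def)
  have S: "z \<in> B - {p} \<and> n z = n y \<and> S z = S y" if y: "y \<in> B - {p}" and z: "z \<in> S y" for y z
  proof -
    have z': "z \<in> B" "R (n y) y z" using z by (auto simp: S_def cell_def)
    have "\<not> R (n y) p z" using n[OF y] codingD(4)[OF R _ codingD(3)[OF R z'(2)]] by blast
    moreover have "R i p z" if "i < n y" for i
      using n_less[OF that] coding_mono[OF R _ z'(2), of i] that codingD(4)[OF R, of i p y z] by simp
    ultimately have nz: "n z = n y"
      unfolding n_def[of z] by (intro Least_equality) (auto simp: not_less[symmetric])
    moreover have "z \<noteq> p" using \<open>\<not> R (n y) p z\<close> codingD(2)[OF R] by auto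
    moreover have "S z = S y" unfolding S_def nz using cell_eq[OF z'(2)] by simp
    ultimately show ?thesis using z'(1) by simp
  qed
  have S_self: "y \<in> S y" if "y \<in> B - {p}" for y using that cell_self by (simp add: S_def)
  define SS where "SS = S ` (B - {p})"
  have SSd: "C = C'" if C: "C \<in> SS" "C' \<in> SS" "z \<in> C" "z \<in> C'" for C C' z
    using C S unfolding SS_def by (metis imageE)
  have SSU: "\<Union>SS = B - {p}" 
  proof (intro equalityI subsetI)
    fix z assume "z \<in> \<Union>SS"
    then obtain y where "y \<in> B - {p}" "z \<in> S y" by (auto simp: SS_def)
    then show "z \<in> B - {p}" using S by blast
  next
    fix z assume "z \<in> B - {p}"
    then show "z \<in> \<Union>SS" using S_self unfolding SS_def by blast
  qed
  have SSB: "C \<in> cells R B" if "C \<in> SS" for C using that cells_cell by (auto simp: SS_def S_def)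
  \<comment> \<open>Finitely many cells \<open>S y\<close> would bound the levels of separation from
    \<open>p\<close>; but no cell around \<open>p\<close> is a singleton, so some points of
    \<open>B\<close> separate from \<open>p\<close> arbitrarily late.\<close>
  have infSS: "infinite SS"
  proof
    assume fin: "finite SS"
    have "n ` (B - {p}) \<subseteq> (\<lambda>C. n (SOME y. y \<in> C)) ` SS"
    proof
      fix i assume "i \<in> n ` (B - {p})"
      then obtain y where y: "y \<in> B - {p}" "i = n y" by blast
      have "(SOME z. z \<in> S y) \<in> S y" using S_self[OF y(1)] by (rule someI)
      then have "n (SOME z. z \<in> S y) = i" using S[OF y(1)] y(2) by blast
      then show "i \<in> (\<lambda>C. n (SOME y. y \<in> C)) ` SS" using y(1) by (auto simp: SS_def)
    qed
    then have "finite (n ` (B - {p}))" using fin by (meson finite_imageI finite_subset)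
    then obtain m where m: "\<forall>i \<in> n ` (B - {p}). i < m" using finite_nat_set_iff_bounded by blast
    have pZ: "p \<in> Z" using p BsubZ by blast
    then obtain y where y: "y \<in> cell R Z (max k m) p" "y \<noteq> p" using noniso[OF pZ] cell_self[OF pZ] by blast
    then have ym: "y \<in> Z" "R (max k m) p y" by (auto simp: cell_def)
    have "R k p y" "R m p y"
      using coding_mono[OF R _ ym(2), of k] coding_mono[OF R _ ym(2), of m] by simp_all
    then have yB: "y \<in> B - {p}" using k[OF p] ym(1) y(2) by (auto simp: cell_def)
    then have "n y < m" using m by blast
    then have "R (n y) p y" using coding_mono[OF R _ \<open>R m p y\<close>] by simp
    then show False using n[OF yB] by blast
  qed
  then obtain f :: "nat \<Rightarrow> 'a set" where f: "inj f" "range f \<subseteq> SS" using infinite_countable_subset by blast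
  have fSS: "f i \<in> SS" for i using f(2) by blast
  define P where "P m = (\<Union>C\<in>SS. level R C (m C))" for m
  have Pcells: "P m \<subseteq> cells R B" for m
  proof
    fix D assume "D \<in> P m"
    then obtain C where "C \<in> SS" "D \<in> cells R C" by (auto simp: P_def cells_def)
    then show "D \<in> cells R B" using cells_trans SSB by blast
  qed
  have Psub: "C \<in> SS \<Longrightarrow> level R C (m C) \<subseteq> P m" for C m by (auto simp: P_def)
  have Pd: "disjoint (P m)" for m
  proof (rule disjointI)
    fix D D' assume D: "D \<in> P m" "D' \<in> P m" "D \<noteq> D'"
    then obtain C C' where C: "C \<in> SS" "D \<in> level R C (m C)" "C' \<in> SS" "D' \<in> level R C' (m C')"
      by (auto simp: P_def)
    show "D \<inter> D' = {}"
    proof (rule ccontr)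
      assume "D \<inter> D' \<noteq> {}"
      then obtain z where z: "z \<in> D" "z \<in> D'" by blast
      then have "C = C'" using SSd C level_subset by (meson subsetD)
      then show False using level_eqI C z D(3) by metis
    qed
  qed
  have PU: "\<Union>(P m) = B - {p}" for m
  proof -
    have "\<Union>(level R C i) = C" for C i
    proof (intro equalityI subsetI)
      fix x assume "x \<in> C"
      then show "x \<in> \<Union>(level R C i)" using level_cell cell_self by (meson UnionI)
    qed (use level_subset in blast)
    moreover have "\<Union>(P m) = (\<Union>C\<in>SS. \<Union>(level R C (m C)))" by (auto simp: P_def)
    ultimately have "\<Union>(P m) = \<Union>SS" by simp
    then show ?thesis using SSU by simp
  qed
  have PR: "R N x y" if m: "\<And>C. N \<le> m C" and D: "D \<in> P m" "x \<in> D" "y \<in> D" for m D x y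
  proof -
    obtain C where "D \<in> level R C (m C)" using D(1) by (auto simp: P_def)
    then have "R (m C) x y" using level_eqI[OF _ D(2)] D(3) by (auto simp: cell_def)
    then show ?thesis using coding_mono[OF R m] by blast
  qed
  have infP: "infinite (P m)" for m
  proof -
    have "\<exists>D. D \<in> level R C (m C)" if C: "C \<in> SS" for C
      using cells_nonempty[OF SSB[OF C]] level_cell by blast
    then have "\<forall>C\<in>SS. \<exists>D. D \<in> level R C (m C)" by blast
    from bchoice[OF this] obtain h where h: "\<forall>C\<in>SS. h C \<in> level R C (m C)" ..
    have "inj_on h SS"
    proof (rule inj_onI)
      fix C C' assume C: "C \<in> SS" "C' \<in> SS" "h C = h C'"
      then have "h C \<subseteq> C" "h C \<subseteq> C'" "h C \<noteq> {}"
        using h level_subset level_nonempty by (metis, metis, metis)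
      then show "C = C'" using SSd C(1,2) by blast
    qed
    moreover have "h ` SS \<subseteq> P m" using h Psub by blast
    ultimately show ?thesis using infSS by (meson finite_imageD finite_subset)
  qed
  have BJ: "cells R B \<approx> J" using hom[OF B] .
  have SSJ: "cells R C \<approx> J" if "C \<in> SS" for C using hom cells_trans[OF B SSB[OF that]] by blast
  have "\<exists>m. (\<forall>C. N \<le> m C) \<and> J \<lesssim> P m"
  \<comment> \<open>In the first case level \<open>i\<close> of \<open>f 0\<close> is embedded in a
    suitable level of \<open>f (Suc i)\<close>. The members are disjoint, so all cells of
    \<open>f 0\<close>, which number \<open>J\<close>, embed in \<open>P m\<close> together. In the
    second case some level of \<open>f 0\<close> dominates every level of one member; the union of
    those has size \<open>J\<close>, so that single level of \<open>f 0\<close> is already large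
    enough unless it is finite.\<close>
  proof (cases "\<forall>i. \<exists>j. level R (f 0) i \<lesssim> level R (f (Suc i)) j")
    case True
    then have "\<forall>i. \<exists>j. N \<le> j \<and> level R (f 0) i \<lesssim> level R (f (Suc i)) j"
      using level_lepoll_mono lepoll_trans by (meson max.cobounded1 max.cobounded2)
    from choice[OF this] obtain j where j: "\<forall>i. N \<le> j i \<and> level R (f 0) i \<lesssim> level R (f (Suc i)) (j i)" ..
    have "\<forall>i. \<exists>h. inj_on h (level R (f 0) i) \<and> h ` level R (f 0) i \<subseteq> level R (f (Suc i)) (j i)"
      using j unfolding lepoll_def by blast
    from choice[OF this] obtain h where
      h: "\<forall>i. inj_on (h i) (level R (f 0) i) \<and> h i ` level R (f 0) i \<subseteq> level R (f (Suc i)) (j i)" ..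
    \<comment> \<open>Truncated subtraction assigns \<open>j 0\<close> to \<open>f 0\<close>; there
      and off the range of \<open>f\<close>, any value of at least \<open>N\<close> will do.\<close>
    define m where "m C = (if C \<in> range f then j (inv f C - 1) else N)" for C
    have m: "m (f (Suc i)) = j i" for i using f(1) by (simp add: m_def)
    define u where "u C = (LEAST i. C \<in> level R (f 0) i)" for C
    have u: "C \<in> level R (f 0) (u C)" if "C \<in> cells R (f 0)" for C
      using that unfolding u_def cells_def by (auto intro: LeastI)
    define g where "g C = h (u C) C" for C
    have g: "g C \<in> level R (f (Suc (u C))) (j (u C))" if "C \<in> cells R (f 0)" for C
      using h u[OF that] unfolding g_def by blast
    have "inj_on g (cells R (f 0))"
    proof (rule inj_onI)
      fix C D assume CD: "C \<in> cells R (f 0)" "D \<in> cells R (f 0)" "g C = g D"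
      have "g C \<subseteq> f (Suc (u C))" "g C \<subseteq> f (Suc (u D))" "g C \<noteq> {}"
        using level_subset[OF g[OF CD(1)]] level_subset[OF g[OF CD(2)]] level_nonempty[OF g[OF CD(1)]] CD(3)
        by simp_all
      then have "f (Suc (u C)) = f (Suc (u D))" using SSd[OF fSS fSS] by blast
      then have "u C = u D" using injD[OF f(1)] by blast
      then show "C = D" using h u[OF CD(1)] u[OF CD(2)] CD(3) unfolding g_def by (metis inj_onD)
    qed
    moreover have "g ` cells R (f 0) \<subseteq> P m"
      using g Psub[OF fSS] m by (metis image_subsetI subsetD)
    ultimately have "cells R (f 0) \<lesssim> P m" unfolding lepoll_def by blast
    then have "J \<lesssim> P m" using SSJ[OF fSS] by (meson eqpoll_sym lepoll_trans1)
    moreover have "N \<le> m C" for C using j by (simp add: m_def)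
    ultimately show ?thesis by blast
  next
    case False
    then obtain i where i: "\<And>j. \<not> level R (f 0) i \<lesssim> level R (f (Suc i)) j" by blast
    have le: "level R (f (Suc i)) j \<lesssim> level R (f 0) i" for j using i lepoll_linear by blast
    have J: "J \<lesssim> (\<Union>j. level R (f (Suc i)) j)"
      using SSJ[OF fSS, of "Suc i"] unfolding cells_def by (meson eqpoll_imp_lepoll eqpoll_sym)
    show ?thesis
    proof (cases "finite (level R (f 0) i)")
      case True
      \<comment> \<open>Now \<open>J\<close> is countable, and any infinite \<open>P\<close> is
        large enough.\<close>
      have "finite (level R (f (Suc i)) j)" for j
        using le[of j] True unfolding lepoll_def by (meson finite_imageD finite_subset)
      then have "countable (\<Union>j. level R (f (Suc i)) j)" by (intro countable_UN) (auto intro: countable_finite)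
      then have "(\<Union>j. level R (f (Suc i)) j) \<lesssim> (UNIV :: nat set)"
        unfolding lepoll_def countable_def by blast
      moreover have "(UNIV :: nat set) \<lesssim> P (\<lambda>_. N)" using infP infinite_le_lepoll by blast
      ultimately have "J \<lesssim> P (\<lambda>_. N)" by (rule lepoll_trans[OF lepoll_trans[OF J]])
      then show ?thesis by (intro exI[of _ "\<lambda>_. N"]) simp
    next
      case False
      have "J \<lesssim> level R (f 0) i" using J UN_nat_lepoll[OF False le] by (rule lepoll_trans)
      also have "\<dots> \<lesssim> level R (f 0) (max N i)" by (rule level_lepoll_mono) simp
      also have "\<dots> \<lesssim> P (\<lambda>_. max N i)" by (rule subset_imp_lepoll) (rule Psub[OF fSS])
      finally show ?thesis by (intro exI[of _ "\<lambda>_. max N i"]) simp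
    qed
  qed
  then obtain m where m: "\<And>C. N \<le> m C" "J \<lesssim> P m" by blast
  have "P m \<lesssim> J" by (rule lepoll_trans2[OF subset_imp_lepoll[OF Pcells] BJ])
  then have "P m \<approx> J" using m(2) by (rule lepoll_antisym)
  moreover have "\<forall>C\<in>P m. \<forall>x\<in>C. \<forall>y\<in>C. R N x y" using PR m(1) by blast
  ultimately show ?thesis using p Pcells Pd PU infP by (intro exI[of _ p] exI[of _ "P m"]) simp
qed

end

text \<open>With the parts of each node labelled by \<open>cells R V \<times> UNIV\<close>, a branch
  is a sequence \<open>j\<close> in \<open>cells R V\<close> together with a binary sequence. For
  fixed \<open>j\<close> the binary sequences sweep out a Cantor set. The points missed are among
  those removed at the nodes.\<close>

lemma homogeneous_cantor_partition:
  assumes R: "coding Z R" and noniso: "\<And>x n. x \<in> Z \<Longrightarrow> cell R Z n x \<noteq> {x}"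
    and V: "V \<in> cells R Z" and hom: "\<And>C. C \<in> cells R V \<Longrightarrow> cells R C \<approx> cells R V"
  shows "\<exists>E P. E \<subseteq> V \<and> sigma_discrete E \<and> cantor_partition (V - E) P"
proof -
  let ?J = "cells R V \<times> (UNIV :: bool set)"
  have VZ: "V \<subseteq> Z" using cells_subset[OF R V] .
  have ZM: "Z \<subseteq> M" using codingD(1)[OF R] .
  obtain v where v: "v \<in> V" using cells_nonempty[OF R V] by blast
  obtain k where k: "\<And>x. x \<in> V \<Longrightarrow> V = cell R Z k x" using cellsE[OF R V] by blast
  have VV: "V \<in> cells R V"
  proof -
    have "cell R V k v = V" using k[OF v] by (auto simp: cell_def)
    then show ?thesis using cells_cell[OF R v, of k] by simp
  qed
  have "\<exists>p g. p \<in> B \<and> (\<forall>a\<in>?J. g a \<in> cells R B) \<and> (\<forall>a\<in>?J. \<forall>b\<in>?J. g a \<inter> g b \<noteq> {} \<longrightarrow> a = b) \<and>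
      (\<Union>a\<in>?J. g a) = B - {p} \<and> (\<forall>a\<in>?J. \<forall>x\<in>g a. \<forall>y\<in>g a. R N x y)"
    if B: "B \<in> cells R V" for B and N :: nat
  proof -
    have "\<exists>p P. p \<in> B \<and> P \<subseteq> cells R B \<and> disjoint P \<and> \<Union>P = B - {p} \<and>
        (\<forall>C\<in>P. \<forall>x\<in>C. \<forall>y\<in>C. R N x y) \<and> infinite P \<and> P \<approx> cells R V"
      by (rule homogeneous_split[OF R _ V _ B]) (fact noniso, fact hom)
    then obtain p P where P: "p \<in> B" "P \<subseteq> cells R B" "disjoint P" "\<Union>P = B - {p}"
        "\<forall>C\<in>P. \<forall>x\<in>C. \<forall>y\<in>C. R N x y" "infinite P" "P \<approx> cells R V"
      by (elim exE conjE)
    have "infinite (cells R V)" using P(6,7) eqpoll_finite_iff by blast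
    then have "?J \<approx> P" using times_bool_eqpoll eqpoll_trans eqpoll_sym[OF P(7)] by blast
    then obtain g where "bij_betw g ?J P" unfolding eqpoll_def by blast
    then have g: "inj_on g ?J" "g ` ?J = P" by (simp_all add: bij_betw_def)
    then have gP: "g a \<in> P" if "a \<in> ?J" for a using that by blast
    have g1: "\<forall>a\<in>?J. g a \<in> cells R B" using gP P(2) by blast
    have g2: "\<forall>a\<in>?J. \<forall>x\<in>g a. \<forall>y\<in>g a. R N x y" using gP P(5) by (intro ballI) blast
    have g3: "a = b" if ab: "a \<in> ?J" "b \<in> ?J" "g a \<inter> g b \<noteq> {}" for a b
    proof -
      have "g a = g b" using P(3) gP[OF ab(1)] gP[OF ab(2)] ab(3) by (meson disjointD)
      then show ?thesis using g(1) ab by (meson inj_onD)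
    qed
    have g4: "(\<Union>a\<in>?J. g a) = B - {p}" using g(2) P(4) by simp
    show ?thesis
      by (intro exI[of _ p] exI[of _ g] conjI P(1) g1 g2 g4 ballI impI) (rule g3)
  qed
  then have "\<forall>B\<in>cells R V. \<forall>N. \<exists>p g. p \<in> B \<and> (\<forall>a\<in>?J. g a \<in> cells R B) \<and> (\<forall>a\<in>?J. \<forall>b\<in>?J. g a \<inter> g b \<noteq> {} \<longrightarrow> a = b) \<and>
      (\<Union>a\<in>?J. g a) = B - {p} \<and> (\<forall>a\<in>?J. \<forall>x\<in>g a. \<forall>y\<in>g a. R N x y)"
    by (intro ballI allI)
  from this[unfolded choice_iff bchoice_iff] obtain p where "\<exists>g. \<forall>B\<in>cells R V. \<forall>N. p B N \<in> B \<and> (\<forall>a\<in>?J. g B N a \<in> cells R B) \<and>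
      (\<forall>a\<in>?J. \<forall>b\<in>?J. g B N a \<inter> g B N b \<noteq> {} \<longrightarrow> a = b) \<and>
      (\<Union>a\<in>?J. g B N a) = B - {p B N} \<and> (\<forall>a\<in>?J. \<forall>x\<in>g B N a. \<forall>y\<in>g B N a. R N x y)" ..
  then obtain g where pg: "\<forall>B\<in>cells R V. \<forall>N. p B N \<in> B \<and> (\<forall>a\<in>?J. g B N a \<in> cells R B) \<and>
      (\<forall>a\<in>?J. \<forall>b\<in>?J. g B N a \<inter> g B N b \<noteq> {} \<longrightarrow> a = b) \<and>
      (\<Union>a\<in>?J. g B N a) = B - {p B N} \<and> (\<forall>a\<in>?J. \<forall>x\<in>g B N a. \<forall>y\<in>g B N a. R N x y)" ..
  have pB: "p B N \<in> B" and gU: "(\<Union>a\<in>?J. g B N a) = B - {p B N}" if "B \<in> cells R V" for B N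
    using pg[rule_format, OF that, of N] by simp_all
  have gc: "g B N a \<in> cells R B" if "B \<in> cells R V" "a \<in> ?J" for B N a
  proof -
    have "\<forall>a\<in>?J. g B N a \<in> cells R B" using pg[THEN bspec, OF that(1), THEN spec, of N] by (elim conjE)
    then show ?thesis using that(2) by (rule bspec)
  qed
  have gR: "R N x y" if "B \<in> cells R V" "a \<in> ?J" "x \<in> g B N a" "y \<in> g B N a" for B N a x y
  proof -
    have "\<forall>a\<in>?J. \<forall>x\<in>g B N a. \<forall>y\<in>g B N a. R N x y"
      using pg[THEN bspec, OF that(1), THEN spec, of N] by (elim conjE)
    from bspec[OF bspec[OF bspec[OF this that(2)] that(3)] that(4)] show ?thesis .
  qed
  have gd: "a = b" if "B \<in> cells R V" "a \<in> ?J" "b \<in> ?J" "z \<in> g B N a" "z \<in> g B N b" for B N a b z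
  proof -
    have "\<forall>a\<in>?J. \<forall>b\<in>?J. g B N a \<inter> g B N b \<noteq> {} \<longrightarrow> a = b"
      using pg[THEN bspec, OF that(1), THEN spec, of N] by (elim conjE)
    from bspec[OF bspec[OF this that(2)] that(3)] show ?thesis using that(4,5) by blast
  qed
  define node where "node a = rec_nat V (\<lambda>n B. g B n (a n))" for a :: "nat \<Rightarrow> 'a set \<times> bool"
  have node0: "node a 0 = V" and nodeS: "node a (Suc n) = g (node a n) n (a n)" for a n
    by (simp_all add: node_def)
  define valid where "valid a \<longleftrightarrow> (\<forall>n. a n \<in> ?J)" for a :: "nat \<Rightarrow> 'a set \<times> bool"
  have node_cells: "node a n \<in> cells R V" if "valid a" for a n
  proof (induction n)
    case (Suc n)
    show ?case using cells_trans[OF R Suc gc[OF Suc]] that by (simp add: nodeS valid_def)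
  qed (simp add: node0 VV)
  have node_Suc: "node a (Suc n) \<subseteq> node a n" if a: "valid a" for a n
  proof -
    have "a n \<in> ?J" using a by (simp add: valid_def)
    then show ?thesis unfolding nodeS by (rule cells_subset[OF R gc[OF node_cells[OF a]]])
  qed
  have node_mono: "node a n \<subseteq> node a m" if "valid a" "m \<le> n" for a m n
    using that(2) by (induction rule: dec_induct) (use node_Suc[OF that(1)] in blast)+
  have node_R: "R n x y" if a: "valid a" "x \<in> node a (Suc n)" "y \<in> node a (Suc n)" for a n x y
  proof -
    have "a n \<in> ?J" using a(1) by (simp add: valid_def)
    then show ?thesis using gR[OF node_cells[OF a(1)] _ a(2,3)[unfolded nodeS]] by simp
  qed
  define pt where "pt a = (SOME x. \<forall>n. x \<in> node a n)" for a
  have pt: "pt a \<in> node a n" if a: "valid a" for a n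
  proof -
    have "\<exists>x. x \<in> node a (Suc j)" for j using cells_nonempty[OF R node_cells[OF a]] by blast
    then have "\<forall>j. \<exists>x. x \<in> node a (Suc j)" by blast
    from choice[OF this] obtain s where s': "\<forall>j. s j \<in> node a (Suc j)" ..
    have s: "s i \<in> node a j" if "j \<le> Suc i" for i j using s' node_mono[OF a that] by blast
    have nZ: "node a j \<subseteq> Z" for j using cells_subset[OF R node_cells[OF a]] VZ by blast
    obtain x where x: "x \<in> Z" "\<And>j. R j (s j) x"
    proof (rule branch_closedD[OF codingD(6)[OF R], of s])
      show "s j \<in> Z" for j using s[of 0 j] nZ by blast
      show "R j (s j) (s k)" if "j \<le> k" for j k
        by (rule node_R[OF a]) (use s that in simp_all)
    qed blast
    have "x \<in> node a m" for m
    proof -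
      have "node a m \<in> cells R Z" using cells_trans[OF R V node_cells[OF a]] .
      then obtain k where k: "\<And>y. y \<in> node a m \<Longrightarrow> node a m = cell R Z k y" using cellsE[OF R] by blast
      \<comment> \<open>The node is a cell of some level \<open>k\<close>; a representative lying in
        it and equivalent to \<open>x\<close> at level \<open>k\<close> puts \<open>x\<close> into
        it.\<close>
      have sm: "s (max m k) \<in> node a m" by (rule s) simp
      have "R k (s (max m k)) x" by (rule coding_mono[OF R _ x(2)]) simp
      then show ?thesis using k[OF sm] x(1) by (simp add: cell_def)
    qed
    then have "\<exists>x. \<forall>n. x \<in> node a n" by blast
    then have "\<forall>n. pt a \<in> node a n" unfolding pt_def by (rule someI_ex)
    then show ?thesis ..
  qed
  have ptV: "pt a \<in> V" if "valid a" for a using pt[OF that, of 0] by (simp add: node0)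
  have pt_eq: "pt a = x" if a: "valid a" and x: "\<And>n. x \<in> node a n" for a x
  proof (rule coding_eqI[OF R])
    show "pt a \<in> Z" using ptV[OF a] VZ by blast
    show "x \<in> Z" using x[of 0] VZ by (auto simp: node0)
    show "R n (pt a) x" for n using node_R[OF a pt[OF a] x] .
  qed
  have pt_inj: "a = b" if a: "valid a" and b: "valid b" and eq: "pt a = pt b" for a b
  proof -
    have step: "a n = b n" if "node a n = node b n" for n
    proof (rule gd[OF node_cells[OF a]])
      show "a n \<in> ?J" "b n \<in> ?J" using a b by (simp_all add: valid_def)
      show "pt a \<in> g (node a n) n (a n)" using pt[OF a, of "Suc n"] by (simp add: nodeS)
      show "pt a \<in> g (node a n) n (b n)" using pt[OF b, of "Suc n"] eq that by (simp add: nodeS)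
    qed
    have "node a n = node b n" for n
      by (induction n) (simp_all add: node0 nodeS step)
    then show ?thesis using step by blast
  qed
  have node_agree: "node a n = node b n" if "agree n a b" for a b n
    using that by (induction n) (simp_all add: node0 nodeS agree_def)
  define f where "f j b = pt (\<lambda>n. (j n, b n))" for j :: "nat \<Rightarrow> 'a set" and b :: "nat \<Rightarrow> bool"
  define JJ where "JJ = {j :: nat \<Rightarrow> 'a set. \<forall>n. j n \<in> cells R V}"
  have val: "valid (\<lambda>n. (j n, b n))" if "j \<in> JJ" for j b using that by (simp add: valid_def JJ_def)
  have f_inj: "i = j \<and> b = c" if ij: "i \<in> JJ" "j \<in> JJ" and eq: "f i b = f j c" for i j b c
  proof -
    have e: "(\<lambda>n. (i n, b n)) = (\<lambda>n. (j n, c n))"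
      by (rule pt_inj[OF val[OF ij(1)] val[OF ij(2)]]) (use eq in \<open>simp add: f_def\<close>)
    have "i n = j n \<and> b n = c n" for n using fun_cong[OF e, of n] by simp
    then show ?thesis by (simp add: fun_eq_iff)
  qed
  have param: "cantor_param (f j)" if j: "j \<in> JJ" for j
    unfolding cantor_param_def
  proof (intro conjI allI impI)
    show "inj (f j)" using f_inj[OF j j] by (auto intro: injI)
    have fV: "f j b \<in> V" for b using ptV[OF val[OF j]] by (simp add: f_def)
    show "range (f j) \<subseteq> M" using fV VZ ZM by blast
    fix s and e :: real assume e: "e > 0"
    have "f j s \<in> Z" using fV VZ by blast
    then obtain n where n: "\<And>y. y \<in> Z \<Longrightarrow> R n (f j s) y \<Longrightarrow> d (f j s) y < e"
      using coding_near[OF R _ e] by blast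
    have "d (f j s) (f j t) < e" if "agree (Suc n) s t" for t
    proof (rule n)
      show "f j t \<in> Z" using fV VZ by blast
      let ?a = "\<lambda>n. (j n, s n)" and ?b = "\<lambda>n. (j n, t n)"
      have "agree (Suc n) ?a ?b" using that by (simp add: agree_def)
      then have "node ?a (Suc n) = node ?b (Suc n)" by (rule node_agree)
      then have "f j t \<in> node ?a (Suc n)" using pt[OF val[OF j], of t "Suc n"] by (simp add: f_def)
      moreover have "f j s \<in> node ?a (Suc n)" unfolding f_def by (rule pt[OF val[OF j]])
      ultimately show "R n (f j s) (f j t)" using node_R[OF val[OF j]] by blast
    qed
    then show "\<exists>n. \<forall>t. agree n s t \<longrightarrow> d (f j s) (f j t) < e" by blast
  qed
  define P where "P = (\<lambda>j. range (f j)) ` JJ"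
  have PV: "\<Union>P \<subseteq> V" using ptV[OF val] by (auto simp: P_def f_def)
  define E where "E = V - \<Union>P"
  have EV: "E \<subseteq> V" by (auto simp: E_def)
  have "cantor_partition (V - E) P"
    unfolding cantor_partition_def
  proof (intro conjI ballI)
    show "\<Union>P = V - E" using PV by (auto simp: E_def)
    show "disjoint P"
    proof (rule disjointI)
      fix A B assume "A \<in> P" "B \<in> P" "A \<noteq> B"
      then obtain i j where ij: "i \<in> JJ" "A = range (f i)" "j \<in> JJ" "B = range (f j)" by (auto simp: P_def)
      show "A \<inter> B = {}"
      proof (rule ccontr)
        assume "A \<inter> B \<noteq> {}"
        then obtain b c where "f i b = f j c" using ij by auto
        then show False using f_inj[OF ij(1,3)] ij(2,4) \<open>A \<noteq> B\<close> by blast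
      qed
    qed
    show "cantor_set K" if "K \<in> P" for K using that param by (auto simp: P_def cantor_set_def)
  qed
  \<comment> \<open>A point that is never removed can be followed down the tree: every node around
    it has a part containing it, and the labels of these parts form a branch that leads to
    it.\<close>
  moreover have "\<exists>m. x = p (cell R V (fst m) x) (snd m)" if x: "x \<in> E" for x
  proof (rule ccontr)
    assume none: "\<nexists>m. x = p (cell R V (fst m) x) (snd m)"
    have np: "x \<noteq> p B n" if B: "B \<in> cells R V" "x \<in> B" for B n
    proof -
      obtain k where "B = cell R V k x" using cellsE[OF R B(1)] B(2) by metis
      then show ?thesis using none by (metis fst_conv snd_conv)
    qed
    define lab where "lab B n = (SOME \<alpha>. \<alpha> \<in> ?J \<and> x \<in> g B n \<alpha>)" for B n
    have lab: "lab B n \<in> ?J \<and> x \<in> g B n (lab B n)" if B: "B \<in> cells R V" "x \<in> B" for B n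
    proof -
      have "x \<in> (\<Union>\<alpha>\<in>?J. g B n \<alpha>)" using gU[OF B(1)] np[OF B] B(2) by simp
      then have "\<exists>\<alpha>. \<alpha> \<in> ?J \<and> x \<in> g B n \<alpha>" by blast
      then show ?thesis unfolding lab_def by (rule someI_ex)
    qed
    define nd where "nd = rec_nat V (\<lambda>n B. g B n (lab B n))"
    have nd0: "nd 0 = V" and ndS: "nd (Suc n) = g (nd n) n (lab (nd n) n)" for n by (simp_all add: nd_def)
    have nd: "nd n \<in> cells R V \<and> x \<in> nd n" for n
    proof (induction n)
      case 0 then show ?case using VV x EV by (auto simp: nd0)
    next
      case (Suc n)
      then have l: "lab (nd n) n \<in> ?J \<and> x \<in> g (nd n) n (lab (nd n) n)" using lab by blast
      have n: "nd n \<in> cells R V" using Suc ..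
      have "nd (Suc n) \<in> cells R (nd n)" unfolding ndS by (rule gc[OF n]) (use l in blast)
      then have "nd (Suc n) \<in> cells R V" by (rule cells_trans[OF R n])
      then show ?case using l by (simp add: ndS)
    qed
    define a where "a n = lab (nd n) n" for n
    have a: "valid a" using lab nd by (simp add: valid_def a_def)
    have "node a n = nd n" for n by (induction n) (simp_all add: node0 nodeS nd0 ndS a_def)
    then have "pt a = x" using pt_eq[OF a] nd by simp
    then have "f (\<lambda>n. fst (a n)) (\<lambda>n. snd (a n)) = x" by (simp add: f_def)
    moreover have "(\<lambda>n. fst (a n)) \<in> JJ" using a by (auto simp: JJ_def valid_def mem_Times_iff)
    ultimately have "x \<in> \<Union>P" unfolding P_def by blast
    then show False using x by (simp add: E_def)
  qed
  then have "\<forall>x\<in>E. \<exists>m. x = p (cell R V (fst m) x) (snd m)" by blast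
  from bchoice[OF this] obtain m where m: "\<forall>x\<in>E. x = p (cell R V (fst (m x)) x) (snd (m x))" ..
  \<comment> \<open>There are countably many pairs \<open>m x\<close>. For a fixed pair, the class
    of \<open>x\<close> at level \<open>fst (m x)\<close> determines \<open>x\<close>, and these
    classes are separated by the coding.\<close>
  have "sigma_sep E (\<lambda>x y. prod_encode (m x) = prod_encode (m y) \<and> x = y)"
  proof (rule sigma_sep_fibrewise[OF sigma_sep_nat])
    fix x assume "x \<in> E"
    let ?F = "{y \<in> E. prod_encode (m y) = prod_encode (m x)}"
    show "sigma_discrete ?F"
    proof (rule sigma_sep_mono[OF codingD(5)[OF R, of "fst (m x)"]])
      show "?F \<subseteq> Z" using EV VZ by blast
      fix y z assume yz: "y \<in> ?F" "z \<in> ?F" "R (fst (m x)) y z"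
      then have eq: "m y = m x" "m z = m x" and yzE: "y \<in> E" "z \<in> E" by simp_all
      have "cell R V (fst (m x)) y = cell R V (fst (m x)) z" by (rule cell_eq[OF R yz(3)])
      then show "y = z" using bspec[OF m yzE(1)] bspec[OF m yzE(2)] unfolding eq by metis
    qed
  qed
  then have "sigma_discrete E" by (rule sigma_sep_mono) auto
  ultimately show ?thesis using EV by blast
qed

section \<open>Exhaustion by cells that are good up to a \<open>\<sigma>\<close>-discrete
  set\<close>

definition cantor_modulo_discrete :: "'a set \<Rightarrow> bool" where
  "cantor_modulo_discrete A \<longleftrightarrow> (\<exists>E P. E \<subseteq> A \<and> sigma_discrete E \<and> cantor_partition (A - E) P)"

text \<open>A singleton cell is its own exceptional set. Otherwise a cell \<open>V\<close> with the
  fewest subcells is homogeneous: the subcells of a cell of \<open>V\<close> are subcells of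
  \<open>V\<close>, and by minimality there are not fewer of them.\<close>

lemma cantor_modulo_discrete_cell:
  assumes R: "coding Z R" and "Z \<noteq> {}"
  shows "\<exists>x n. x \<in> Z \<and> cantor_modulo_discrete (cell R Z n x)"
proof (cases "\<exists>x\<in>Z. \<exists>n. cell R Z n x = {x}")
  case True
  then obtain x n where "x \<in> Z" "cell R Z n x = {x}" by blast
  moreover have "cantor_modulo_discrete {x}"
    unfolding cantor_modulo_discrete_def
    by (intro exI[of _ "{x}"] exI[of _ "{}"]) (simp add: sigma_sep_def cantor_partition_def)
  ultimately show ?thesis by metis
next
  case False
  obtain z where "z \<in> Z" using assms(2) by blast
  then have "cells R Z \<noteq> {}" using cells_cell[OF R] by blast
  from exists_minimal_lepoll[OF this, of "cells R"]
  obtain V where V: "V \<in> cells R Z" "\<And>C. C \<in> cells R Z \<Longrightarrow> cells R V \<lesssim> cells R C" by blast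
  have "\<exists>E P. E \<subseteq> V \<and> sigma_discrete E \<and> cantor_partition (V - E) P"
  proof (rule homogeneous_cantor_partition[OF R _ V(1)])
    show "cell R Z n x \<noteq> {x}" if "x \<in> Z" for x n using False that by blast
    fix C assume C: "C \<in> cells R V"
    have "cells R C \<subseteq> cells R V" using cells_trans[OF R C] by blast
    then show "cells R C \<approx> cells R V"
      using V(2)[OF cells_trans[OF R V(1) C]] by (intro lepoll_antisym[OF subset_imp_lepoll])
  qed
  then have "cantor_modulo_discrete V" by (simp add: cantor_modulo_discrete_def)
  moreover obtain x where "x \<in> V" using cells_nonempty[OF R V(1)] by blast
  moreover obtain n where "V = cell R Z n x" using cellsE[OF R V(1)] \<open>x \<in> V\<close> by metis
  ultimately show ?thesis using cells_subset[OF R V(1)] by blast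
qed

text \<open>The fibres may be uncountably many; the union of their exceptional sets stays
  \<open>\<sigma>\<close>-discrete because the fibres are separated.\<close>

lemma cantor_modulo_discrete_fibres:
  assumes sep: "sigma_sep A (\<lambda>x y. i x = i y)" and fib: "\<And>x. x \<in> A \<Longrightarrow> cantor_modulo_discrete {y\<in>A. i y = i x}"
  shows "cantor_modulo_discrete A"
proof -
  have "\<forall>v\<in>i ` A. \<exists>E P. E \<subseteq> {y\<in>A. i y = v} \<and> sigma_discrete E \<and> cantor_partition ({y\<in>A. i y = v} - E) P"
    using fib unfolding cantor_modulo_discrete_def by blast
  from bchoice[OF this] obtain E where
    "\<forall>v\<in>i ` A. \<exists>P. E v \<subseteq> {y\<in>A. i y = v} \<and> sigma_discrete (E v) \<and> cantor_partition ({y\<in>A. i y = v} - E v) P" ..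
  from bchoice[OF this] obtain P where
    EP: "\<forall>v\<in>i ` A. E v \<subseteq> {y\<in>A. i y = v} \<and> sigma_discrete (E v) \<and> cantor_partition ({y\<in>A. i y = v} - E v) (P v)" ..
  have E: "E v \<subseteq> {y\<in>A. i y = v}" "sigma_discrete (E v)" and P: "cantor_partition ({y\<in>A. i y = v} - E v) (P v)"
    if "v \<in> i ` A" for v using bspec[OF EP that] by simp_all
  define EE where "EE = (\<Union>v\<in>i ` A. E v)"
  define PP where "PP = (\<Union>v\<in>i ` A. P v)"
  have EEA: "EE \<subseteq> A" using E(1) unfolding EE_def by blast
  have EEi: "y \<in> E (i y)" if y: "y \<in> EE" for y
  proof -
    obtain v where v: "v \<in> i ` A" "y \<in> E v" using y by (auto simp: EE_def)
    then have "i y = v" using subsetD[OF E(1)[OF v(1)] v(2)] by simp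
    then show ?thesis using v(2) by simp
  qed
  have "sigma_sep EE (\<lambda>x y. i x = i y \<and> x = y)"
  proof (rule sigma_sep_fibrewise)
    show "sigma_sep EE (\<lambda>x y. i x = i y)" using sep EEA by (rule sigma_sep_mono)
    fix x assume x: "x \<in> EE"
    show "sigma_discrete {y \<in> EE. i y = i x}"
    proof (rule sigma_sep_mono[OF E(2)[of "i x"]])
      show "i x \<in> i ` A" using x EEA by blast
      show "{y \<in> EE. i y = i x} \<subseteq> E (i x)"
      proof
        fix y assume "y \<in> {y \<in> EE. i y = i x}"
        then show "y \<in> E (i x)" using EEi[of y] by simp
      qed
    qed
  qed
  then have "sigma_discrete EE" by (rule sigma_sep_mono) auto
  moreover have "cantor_partition (A - EE) PP"
    unfolding cantor_partition_def
  proof (intro conjI ballI)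
    have PvU: "\<Union>(P v) = {y\<in>A. i y = v} - E v" if "v \<in> i ` A" for v
      using P[OF that] by (simp add: cantor_partition_def)
    have "\<Union>PP = (\<Union>v\<in>i ` A. \<Union>(P v))" by (auto simp: PP_def)
    also have "\<dots> = (\<Union>v\<in>i ` A. {y\<in>A. i y = v} - E v)" using PvU by simp
    also have "\<dots> = A - EE"
    proof (intro equalityI subsetI)
      fix y assume "y \<in> (\<Union>v\<in>i ` A. {y\<in>A. i y = v} - E v)"
      then have "y \<in> A" "y \<notin> E (i y)" by auto
      then show "y \<in> A - EE" using EEi by blast
    next
      fix y assume "y \<in> A - EE"
      then show "y \<in> (\<Union>v\<in>i ` A. {y\<in>A. i y = v} - E v)" by (auto simp: EE_def)
    qed
    finally show "\<Union>PP = A - EE" .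
    show "cantor_set K" if "K \<in> PP" for K using that P by (auto simp: PP_def cantor_partition_def)
    show "disjoint PP"
    proof (rule disjointI)
      fix K L assume "K \<in> PP" "L \<in> PP" "K \<noteq> L"
      then obtain v w where vw: "v \<in> i ` A" "K \<in> P v" "w \<in> i ` A" "L \<in> P w" by (auto simp: PP_def)
      then have "K \<subseteq> {y\<in>A. i y = v}" "L \<subseteq> {y\<in>A. i y = w}"
        using PvU[OF vw(1)] PvU[OF vw(3)] by blast+
      then have "K \<inter> L = {}" if "v \<noteq> w" using that by blast
      moreover have "K \<inter> L = {}" if "v = w"
        using P[OF vw(1)] vw that \<open>K \<noteq> L\<close> by (auto simp: cantor_partition_def dest: disjointD)
      ultimately show "K \<inter> L = {}" by blast
    qed
  qed
  ultimately show ?thesis using EEA unfolding cantor_modulo_discrete_def by blast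
qed

text \<open>Transfinite exhaustion: whatever is not yet covered is again coded, so one of its cells can be
  removed next. A well-order of the power set is long enough for this to stop.\<close>

lemma cantor_modulo_discrete_coding:
  assumes R: "coding X R"
  shows "cantor_modulo_discrete X"
proof -
  obtain r0 :: "'a set rel" where r0: "well_order_on UNIV r0" using well_order_on by blast
  define r where "r = r0 - Id"
  have wf: "wf r" using r0 by (simp add: r_def well_order_on_def)
  have total: "(\<alpha>, \<beta>) \<in> r \<or> (\<beta>, \<alpha>) \<in> r \<or> \<alpha> = \<beta>" for \<alpha> \<beta>
    using r0 by (auto simp: r_def well_order_on_def linear_order_on_def total_on_def)
  define pick where "pick Z = (SOME m. fst m \<in> Z \<and> cantor_modulo_discrete (cell R Z (snd m) (fst m)))" for Z
  \<comment> \<open>The full class rather than its part in \<open>Z\<close>, so that membership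
    depends only on the class at one level.\<close>
  define ball where "ball Z = (if Z = {} then {} else {y. R (snd (pick Z)) (fst (pick Z)) y})" for Z
  define H where "H f \<alpha> = ball (X - \<Union>(f ` {\<beta>. (\<beta>, \<alpha>) \<in> r}))" for f \<alpha>
  define U where "U = wfrec r H"
  define Z where "Z \<alpha> = X - \<Union>(U ` {\<beta>. (\<beta>, \<alpha>) \<in> r})" for \<alpha>
  have U: "U \<alpha> = ball (Z \<alpha>)" for \<alpha>
  proof -
    have "cut U r \<alpha> ` {\<beta>. (\<beta>, \<alpha>) \<in> r} = U ` {\<beta>. (\<beta>, \<alpha>) \<in> r}" by (intro image_cong) (auto simp: cut_apply)
    then show ?thesis using wfrec[OF wf, of H \<alpha>] by (simp add: U_def H_def Z_def)
  qed
  have cZ: "coding (Z \<alpha>) R" for \<alpha>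
  proof -
    have "branch_closed (Z \<alpha>) R"
      unfolding branch_closed_def
    proof (intro allI impI)
      fix s assume s: "(\<forall>j. s j \<in> Z \<alpha>) \<and> (\<forall>j k. j \<le> k \<longrightarrow> R j (s j) (s k))"
      then have sX: "s j \<in> X" for j by (auto simp: Z_def)
      obtain x where x: "x \<in> X" "\<And>j. R j (s j) x"
        by (rule branch_closedD[OF codingD(6)[OF R], of s]) (use s sX in auto)
      \<comment> \<open>\<open>U \<beta>\<close> is a class of one level \<open>?n\<close>. If it
        contained the limit, it would contain the representative \<open>s ?n\<close>, which has not
        been removed.\<close>
      have "x \<notin> U \<beta>" if \<beta>: "(\<beta>, \<alpha>) \<in> r" for \<beta>
      proof
        assume xU: "x \<in> U \<beta>"
        let ?n = "snd (pick (Z \<beta>))"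
        have ne: "Z \<beta> \<noteq> {}" using xU by (auto simp: U ball_def)
        then have "R ?n (fst (pick (Z \<beta>))) x" using xU by (simp add: U ball_def)
        then have "R ?n (fst (pick (Z \<beta>))) (s ?n)"
          using codingD(4)[OF R _ codingD(3)[OF R x(2)]] by blast
        then have "s ?n \<in> U \<beta>" using ne by (simp add: U ball_def)
        moreover have "s ?n \<in> Z \<alpha>" using s by blast
        ultimately show False using \<beta> by (auto simp: Z_def)
      qed
      then have "x \<in> Z \<alpha>" using x(1) by (auto simp: Z_def)
      then show "\<exists>x\<in>Z \<alpha>. \<forall>j. R j (s j) x" using x(2) by blast
    qed
    then show ?thesis by (rule coding_subset[OF R, rotated]) (auto simp: Z_def)
  qed
  have pick: "fst (pick (Z \<alpha>)) \<in> Z \<alpha> \<and> cantor_modulo_discrete (cell R (Z \<alpha>) (snd (pick (Z \<alpha>))) (fst (pick (Z \<alpha>))))"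
    if ne: "Z \<alpha> \<noteq> {}" for \<alpha>
  proof -
    have "\<exists>m. fst m \<in> Z \<alpha> \<and> cantor_modulo_discrete (cell R (Z \<alpha>) (snd m) (fst m))"
      using cantor_modulo_discrete_cell[OF cZ ne] by simp
    then show ?thesis unfolding pick_def by (rule someI_ex)
  qed
  have "\<exists>\<alpha>. Z \<alpha> = {}"
  proof (rule ccontr)
    assume none: "\<nexists>\<alpha>. Z \<alpha> = {}"
    define q where "q \<alpha> = fst (pick (Z \<alpha>))" for \<alpha>
    have qZ: "q \<alpha> \<in> Z \<alpha>" for \<alpha> using pick none by (simp add: q_def)
    have qU: "q \<alpha> \<in> U \<alpha>" for \<alpha> using none codingD(2)[OF R] by (simp add: U ball_def q_def)
    have ne: "q \<alpha> \<noteq> q \<beta>" if "(\<alpha>, \<beta>) \<in> r" for \<alpha> \<beta>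
      using qU[of \<alpha>] qZ[of \<beta>] that by (auto simp: Z_def)
    have "inj q" using ne total by (metis injI)
    then have "inv q ` UNIV = Pow UNIV" using inj_imp_surj_inv by auto
    then show False using Cantors_theorem by blast
  qed
  then obtain \<alpha>0 where "Z \<alpha>0 = {}" by blast
  then have ex: "\<exists>\<beta>. x \<in> U \<beta>" if "x \<in> X" for x using that by (auto simp: Z_def)
  define i where "i x = (SOME \<beta>. x \<in> U \<beta> \<and> (\<forall>\<gamma>. (\<gamma>, \<beta>) \<in> r \<longrightarrow> x \<notin> U \<gamma>))" for x
  have i: "x \<in> U (i x) \<and> (\<forall>\<gamma>. (\<gamma>, i x) \<in> r \<longrightarrow> x \<notin> U \<gamma>)" if x: "x \<in> X" for x
  proof -
    obtain \<beta> where "\<beta> \<in> {\<beta>. x \<in> U \<beta>}" "\<And>\<gamma>. (\<gamma>, \<beta>) \<in> r \<Longrightarrow> \<gamma> \<notin> {\<beta>. x \<in> U \<beta>}"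
      using wfE_min[OF wf, of _ "{\<beta>. x \<in> U \<beta>}"] ex[OF x] by blast
    then have "\<exists>\<beta>. x \<in> U \<beta> \<and> (\<forall>\<gamma>. (\<gamma>, \<beta>) \<in> r \<longrightarrow> x \<notin> U \<gamma>)" by blast
    then show ?thesis unfolding i_def by (rule someI_ex)
  qed
  have iU: "U (i x) = {y. R (snd (pick (Z (i x)))) (fst (pick (Z (i x)))) y}" "Z (i x) \<noteq> {}" if "x \<in> X" for x
    using i[OF that] by (auto simp: U ball_def)
  have fibre: "{y\<in>X. i y = i x} = cell R (Z (i x)) (snd (pick (Z (i x)))) (fst (pick (Z (i x))))" if x: "x \<in> X" for x
  proof -
    have "y \<in> X \<and> i y = i x \<longleftrightarrow> y \<in> Z (i x) \<and> y \<in> U (i x)" for y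
    proof
      assume "y \<in> X \<and> i y = i x"
      then show "y \<in> Z (i x) \<and> y \<in> U (i x)" using i[of y] by (auto simp: Z_def)
    next
      assume y: "y \<in> Z (i x) \<and> y \<in> U (i x)"
      then have yX: "y \<in> X" by (simp add: Z_def)
      have "(i x, i y) \<notin> r" using i[OF yX] y by blast
      moreover have "(i y, i x) \<notin> r" using i[OF yX] y by (auto simp: Z_def)
      ultimately show "y \<in> X \<and> i y = i x" using total yX by blast
    qed
    then show ?thesis using iU(1)[OF x] by (auto simp: cell_def)
  qed
  show ?thesis
  proof (rule cantor_modulo_discrete_fibres)
    show "cantor_modulo_discrete {y\<in>X. i y = i x}" if "x \<in> X" for x
      using fibre[OF that] pick[OF iU(2)[OF that]] by simp
    \<comment> \<open>Points are grouped by the level of the class that first catches them. Within a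
      group, points equivalent at that level are caught by each other's classes, hence at the same
      stage.\<close>
    define N where "N x = snd (pick (Z (i x)))" for x
    have "sigma_sep X (\<lambda>x y. N x = N y \<and> i x = i y)"
    proof (rule sigma_sep_fibrewise[OF sigma_sep_nat])
      fix x
      show "sigma_sep {y \<in> X. N y = N x} (\<lambda>y z. i y = i z)"
      proof (rule sigma_sep_mono[OF codingD(5)[OF R, of "N x"]])
        fix y z assume yz: "y \<in> {y \<in> X. N y = N x}" "z \<in> {y \<in> X. N y = N x}" and R': "R (N x) y z"
        have *: "w \<in> U (i v)" if "v \<in> X" "N v = N x" "R (N x) v w" for v w
        proof -
          have "R (N x) (fst (pick (Z (i v)))) v"
            using i[OF that(1)] iU(1)[OF that(1)] that(2) by (auto simp: N_def)
          then show ?thesis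
            using codingD(4)[OF R _ that(3)] iU(1)[OF that(1)] that(2) by (auto simp: N_def)
        qed
        have "z \<in> U (i y)" using *[of y z] yz R' by blast
        moreover have "y \<in> U (i z)" using *[of z y] yz codingD(3)[OF R R'] by blast
        ultimately have "(i y, i z) \<notin> r" "(i z, i y) \<notin> r" using i yz by blast+
        then show "i y = i z" using total by blast
      qed blast
    qed
    then show "sigma_sep X (\<lambda>x y. i x = i y)" by (rule sigma_sep_mono) auto
  qed
qed

lemma cantor_partition_if_cover:
  assumes "mcomplete" "X \<in> borel_sets_in mtopology"
    and cover: "\<And>x. x \<in> X \<Longrightarrow> \<exists>K. x \<in> K \<and> K \<subseteq> X \<and> cantor_set K"
  shows "\<exists>P. cantor_partition X P"
proof -
  obtain R where R: "coding X R" using coding_borel[OF assms(1,2)] by blast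
  then obtain E P where E: "E \<subseteq> X" "sigma_discrete E" "cantor_partition (X - E) P"
    using cantor_modulo_discrete_coding unfolding cantor_modulo_discrete_def by blast
  show ?thesis
    by (rule cantor_partition_absorb[OF codingD(1)[OF R] E]) (use cover E(1) in blast)
qed

end

section \<open>Transfer between \<open>X\<close> and its metric copy\<close>

lemma homeomorphic_space_subtopology_image:
  assumes f: "homeomorphic_map X Y f" and "K \<subseteq> topspace X"
  shows "subtopology X K homeomorphic_space subtopology Y (f ` K)"
proof -
  have "homeomorphic_map (subtopology X K) (subtopology Y (f ` K)) f"
    using homeomorphic_imp_surjective_map[OF f] assms(2) by (intro homeomorphic_map_subtopologies f) auto
  then show ?thesis unfolding homeomorphic_space by blast
qed

theorem theorem4p3:
  fixes X :: "'a topology"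
  assumes "absolute_Borel_space TYPE('b) X"
  shows "cantor_partitionable X \<longleftrightarrow> cantor_coverable X"
proof
  assume "cantor_partitionable X"
  then show "cantor_coverable X"
    unfolding cantor_partitionable_def cantor_coverable_def partition_on_def by blast
next
  assume "cantor_coverable X"
  then obtain C where C: "\<Union>C = topspace X" "\<And>K. K \<in> C \<Longrightarrow> subtopology X K homeomorphic_space cantor_topology"
    unfolding cantor_coverable_def by blast
  obtain Y :: "'b topology" and B where Y: "completely_metrizable_space Y" and B: "B \<in> borel_sets_in Y"
    and XB: "X homeomorphic_space subtopology Y B"
    using assms unfolding absolute_Borel_space_def by blast
  obtain M d where Md: "Metric_space M d" "Metric_space.mcomplete M d" "Y = Metric_space.mtopology M d"
    using Y unfolding completely_metrizable_space_def by blast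
  interpret Metric_space M d by (rule Md(1))
  have "{U. openin Y U} \<subseteq> Pow (topspace Y)" using openin_subset by blast
  from sigma_sets_into_sp[OF this B[unfolded borel_sets_in_def]] have BM: "B \<subseteq> M" by (simp add: Md(3))
  obtain f g where f: "homeomorphic_maps X (subtopology Y B) f g"
    using XB unfolding homeomorphic_space_def by blast
  then have fm: "homeomorphic_map X (subtopology Y B) f" and gm: "homeomorphic_map (subtopology Y B) X g"
    using homeomorphic_maps_map by blast+
  have tB: "topspace (subtopology Y B) = B" using BM Md(3) by auto
  have fB: "f ` topspace X = B" using homeomorphic_imp_surjective_map[OF fm] tB by simp
  have gB: "g ` B = topspace X" and g_inj: "inj_on g B"
    using homeomorphic_imp_surjective_map[OF gm] homeomorphic_imp_injective_map[OF gm] tB by simp_all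
  \<comment> \<open>The cover is carried by \<open>f\<close> to \<open>B\<close>, where the metric
    is available; the partition found there returns by \<open>g\<close>.\<close>
  have "\<exists>K. y \<in> K \<and> K \<subseteq> B \<and> cantor_set K" if y: "y \<in> B" for y
  proof -
    obtain x where x: "x \<in> topspace X" "y = f x" using y fB by blast
    then obtain K where K: "K \<in> C" "x \<in> K" using C(1) by blast
    have KX: "K \<subseteq> topspace X" using K(1) C(1) by blast
    then have fK: "f ` K \<subseteq> B" using fB by blast
    have "subtopology Y (f ` K) = subtopology (subtopology Y B) (f ` K)"
      using fK by (simp add: subtopology_subtopology Int_absorb1)
    then have "subtopology Y (f ` K) homeomorphic_space cantor_topology"
      using homeomorphic_space_subtopology_image[OF fm KX] C(2)[OF K(1)] 
      by (metis homeomorphic_space_sym homeomorphic_space_trans)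
    then have "cantor_set (f ` K)" using cantor_set_iff fK BM Md(3) by blast
    then show ?thesis using K(2) x(2) fK by blast
  qed
  then obtain P where P: "cantor_partition B P"
    using cantor_partition_if_cover[of B] Md(2,3) B by blast
  have PB: "K \<subseteq> B" if "K \<in> P" for K using P that by (auto simp: cantor_partition_def)
  show "cantor_partitionable X"
    unfolding cantor_partitionable_def
  proof (intro exI[of _ "(`) g ` P"] conjI ballI)
    show "partition_on (topspace X) ((`) g ` P)"
    proof (rule partition_onI)
      have "\<Union>((`) g ` P) = g ` \<Union>P" by blast
      then show "\<Union>((`) g ` P) = topspace X" using P gB by (simp add: cantor_partition_def)
      show "{} \<notin> (`) g ` P"
        using P cantor_set_nonempty by (auto simp: cantor_partition_def)
      fix p q assume "p \<in> (`) g ` P" "q \<in> (`) g ` P" "p \<noteq> q"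
      then obtain K L where KL: "K \<in> P" "L \<in> P" "p = g ` K" "q = g ` L" "K \<noteq> L" by blast
      then have "K \<inter> L = {}" using P by (auto simp: cantor_partition_def dest: disjointD)
      then have "g ` K \<inter> g ` L = {}" using inj_on_image_Int[OF g_inj PB[OF KL(1)] PB[OF KL(2)]] by simp
      then show "disjnt p q" using KL by (simp add: disjnt_def)
    qed
    fix p assume "p \<in> (`) g ` P"
    then obtain K where K: "K \<in> P" "p = g ` K" by blast
    have "cantor_set K" using P K(1) by (simp add: cantor_partition_def)
    then have "subtopology Y K homeomorphic_space cantor_topology"
      using cantor_set_iff PB[OF K(1)] BM Md(3) by blast
    moreover have "subtopology (subtopology Y B) K = subtopology Y K"
      using PB[OF K(1)] by (simp add: subtopology_subtopology Int_absorb1)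
    moreover have "subtopology (subtopology Y B) K homeomorphic_space subtopology X (g ` K)"
      by (rule homeomorphic_space_subtopology_image[OF gm]) (simp only: tB PB[OF K(1)])
    ultimately show "subtopology X p homeomorphic_space cantor_topology"
      unfolding K(2) by (metis homeomorphic_space_sym homeomorphic_space_trans)
  qed
qed

end
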